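(* Let $S_{g,n}$, $\mathcal{T}=(V,E,F)$ be as in the context. Let $\hat k,\hat k^*\in\mathbb{R}_{>0}^{|V^{\partial}|}$ be two sets of prescribed boundary geodesic curvatures, let $\hat T\in\mathfrak{T}$, and let $P$ and $P^*$ be the generalized circle packings on $S_{g,n}$ that realize $(\hat k,\hat T)$ and $(\hat k^*,\hat T)$ respectively. Let $k(P(v))$ and $k(P^*(v))$ denote the geodesic curvatures at the vertex $v\in V$ in $P$ and $P^*$. Then: (a) the maximum over $v\in V$ of $k(P^*(v))/k(P(v))$, if $>1$, is never attained at an interior vertex; and (b) in particular, if the inequality $k(P^*(v))\le k(P(v))$ is true for each boundary vertex $v$, then it holds for all vertices $v\in V$.
   Context: **Generalized circles.** In the hyperbolic plane $\mathbb{H}^2$ (curvature $-1$) a generalized circle is a circle, a horocycle or a hypercycle (a curve at constant distance from a geodesic, its axis). Its shape is determined by its constant geodesic curvature $k>0$: if $k>1$ it is a circle of radius $\operatorname{arccoth}k$; if $k=1$ a horocycle; if $0<k<1$ a hypercycle at distance $\operatorname{arctanh}k$ from its axis. The center is the usual center, the limiting ideal point, or the axis, respectively. Externally tangent means tangent with the convex sides (disk, horodisk, side containing the axis) having disjoint interiors. **Packing of one triangle.** For a triangle $f$ with vertices $v_1,v_2,v_3$ and $(k_1,k_2,k_3)\in\mathbb{R}_{>0}^3$, it is known that there is a configuration $P(f)$, determined by $(k_1,k_2,k_3)$ up to isometry, of three mutually externally tangent generalized circles $C_1,C_2,C_3$ in $\mathbb{H}^2$ with geodesic curvatures $k_1,k_2,k_3$,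 together with a hyperbolic circle $C_f$ (the dual circle) perpendicular to each $C_i$ and passing through all the tangent points. Let $l_i^f$ be the length of the sub-arc of $C_i$ contained in (inside) $C_f$, and $T_i^f=k_i\,l_i^f$ its total geodesic curvature. Joining the centers by shortest geodesics gives the (generalized) hyperbolic triangle $\hat f$. **Surface and triangulation.** $S_{g,n}$ is obtained by removing $n\ge 1$ topological open disks from an oriented compact surface of genus $g\ge 0$. $\mathcal{T}=(V,E,F)$ is a triangulation; $V_f$ is the set of three vertices of $f\in F$. $V^{\partial}$ and $V^{\circ}$ are the sets of boundary and interior vertices, $V=V^{\circ}\cup V^{\partial}$, each enumerated $1,2,\dots$. It is assumed that there are at least two boundary vertices and that each face has at most two boundary vertices. **Packing on the surface.** Curvatures in $\mathbb{R}_{>0}^{|V|}$ determine a packing $P(f)$ for each face; gluing the triangles $\hat f$ along edges gives a surface with hyperbolic conical metric, and the resulting pattern is a generalized circle packing $P$ on $S_{g,n}$. The total geodesic curvature at $v\in V^{\circ}$ is $T_v=\sum_{f\in F,\,v\in V_f}T_v^f$. $P$ realizes $(\hat k,\hat T)$ if its geodesic curvature equals $\hat k$ on $V^{\partial}$ and its total geodesic curvature equals $\hat T$ on $V^{\circ}$. For $\hat T\in\mathfrak{T}$ such a packing exists and is unique up to isometry. For $I\subset V^{\circ}$, $F_I=\{f\in F\mid \exists v\in I,\ v\in V_f\}$, and $\mathfrak{T}=\{(T_1,\ldots,T_{|V^{\circ}|})\in\mathbb{R}^{|V^{\circ}|}_{>0}\mid \sum_{v\in I}T_v<\pi|F_I|\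 \forall\,\emptyset\ne I\subset V^{\circ}\}$. *)

theory Defs
  imports "HOL-Analysis.Analysis" "HOL-Homology.Homology"
begin

section \<open>The hyperbolic plane\<close>

text \<open>
  The hyperbolic plane is realized as the upper sheet of the hyperboloid in Minkowski space
  $R^{2,1}$, whose points are written as pairs (space, time). On tangent vectors of the sheet
  the Minkowski form is the Riemannian metric of curvature $-1$.
\<close>

type_synonym mvec = "complex \<times> real"

definition mink :: "mvec \<Rightarrow> mvec \<Rightarrow> real" where
  "mink x y = fst x \<bullet> fst y - snd x * snd y"

definition hplane :: "mvec set" where
  "hplane = {x. mink x x = - 1 \<and> snd x > 0}"

definition hdist :: "mvec \<Rightarrow> mvec \<Rightarrow> real" where
  "hdist x y = arcosh (- mink x y)"

text \<open>The geodesic with unit spacelike normal \<open>n\<close>.\<close>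

definition hgeodesic :: "mvec \<Rightarrow> mvec set" where
  "hgeodesic n = {x \<in> hplane. mink x n = 0}"

definition hdist_geodesic :: "mvec \<Rightarrow> mvec \<Rightarrow> real" where
  "hdist_geodesic x n = (INF y\<in>hgeodesic n. hdist x y)"


section \<open>Generalized circles\<close>

text \<open>
  A horocycle is given by a future null vector \<open>u\<close>: the ray of \<open>u\<close> is its ideal
  center and the scale of \<open>u\<close> singles out one horocycle with that center. A hypercycle is
  given by the unit normal \<open>n\<close> of its axis and its distance from the axis; it is the branch
  of the equidistant curve on the side of the axis away from \<open>n\<close>.
\<close>

datatype gcircle = Circle mvec real | Horocycle mvec | Hypercycle mvec real

fun gcircle_ok :: "gcircle \<Rightarrow> bool" where
  "gcircle_ok (Circle p r) \<longleftrightarrow> p \<in> hplane \<and> r > 0"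
| "gcircle_ok (Horocycle u) \<longleftrightarrow> mink u u = 0 \<and> snd u > 0"
| "gcircle_ok (Hypercycle n d) \<longleftrightarrow> mink n n = 1 \<and> d > 0"

fun gpoints :: "gcircle \<Rightarrow> mvec set" where
  "gpoints (Circle p r) = {x \<in> hplane. hdist p x = r}"
| "gpoints (Horocycle u) = {x \<in> hplane. mink x u = - 1}"
| "gpoints (Hypercycle n d) = {x \<in> hplane. mink x n < 0 \<and> hdist_geodesic x n = d}"

text \<open>The interior of the convex side: open disk, open horodisk, open side containing the axis.\<close>

fun ginside :: "gcircle \<Rightarrow> mvec set" where
  "ginside (Circle p r) = {x \<in> hplane. hdist p x < r}"
| "ginside (Horocycle u) = {x \<in> hplane. mink x u > - 1}"
| "ginside (Hypercycle n d) = {x \<in> hplane. mink x n \<ge> 0 \<or> hdist_geodesic x n < d}"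

text \<open>
  The constant geodesic curvature \<open>k\<close>: \<open>r = arccoth k\<close> for a circle of radius \<open>r\<close>,
  \<open>k = 1\<close> for a horocycle, \<open>d = arctanh k\<close> for a hypercycle at distance \<open>d\<close>.
\<close>

fun geod_curv :: "gcircle \<Rightarrow> real" where
  "geod_curv (Circle p r) = 1 / tanh r"
| "geod_curv (Horocycle u) = 1"
| "geod_curv (Hypercycle n d) = tanh d"


section \<open>Tangency, perpendicularity, length\<close>

definition tangent_vectors :: "mvec set \<Rightarrow> mvec \<Rightarrow> mvec set" where
  "tangent_vectors C x =
     {v. \<exists>\<gamma>. (\<forall>t::real. \<gamma> t \<in> C) \<and> \<gamma> 0 = x \<and> (\<gamma> has_vector_derivative v) (at 0)}"

definition externally_tangent :: "gcircle \<Rightarrow> gcircle \<Rightarrow> bool" where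
  "externally_tangent C D \<longleftrightarrow>
     (\<exists>x \<in> gpoints C \<inter> gpoints D.
        tangent_vectors (gpoints C) x = tangent_vectors (gpoints D) x) \<and>
     ginside C \<inter> ginside D = {}"

definition perpendicular :: "gcircle \<Rightarrow> gcircle \<Rightarrow> bool" where
  "perpendicular C D \<longleftrightarrow>
     gpoints C \<inter> gpoints D \<noteq> {} \<and>
     (\<forall>x \<in> gpoints C \<inter> gpoints D.
        \<forall>v \<in> tangent_vectors (gpoints C) x. \<forall>w \<in> tangent_vectors (gpoints D) x. mink v w = 0)"

text \<open>The length of \<open>A\<close> does not depend on the injective \<open>C\<^sup>1\<close> parametrization \<open>\<gamma>\<close>.\<close>

definition hlength :: "mvec set \<Rightarrow> real" where
  "hlength A =
     (THE l. \<exists>\<gamma>. arc \<gamma> \<and> \<gamma> C1_differentiable_on {0..1} \<and> path_image \<gamma> = A \<and>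
        l = integral {0..1} (\<lambda>t. sqrt (mink (vector_derivative \<gamma> (at t))
                                             (vector_derivative \<gamma> (at t)))))"


section \<open>Packing of one triangle\<close>

text \<open>
  Here \<open>W\<close> is the set of the three vertices of a face, \<open>C\<close> assigns the circles to them and
  \<open>D\<close> is the dual circle.
\<close>

definition triangle_packing :: "'v set \<Rightarrow> ('v \<Rightarrow> gcircle) \<Rightarrow> gcircle \<Rightarrow> bool" where
  "triangle_packing W C D \<longleftrightarrow>
     (\<forall>v\<in>W. gcircle_ok (C v)) \<and>
     (\<forall>v\<in>W. \<forall>w\<in>W. v \<noteq> w \<longrightarrow> externally_tangent (C v) (C w)) \<and>
     gcircle_ok D \<and> (\<exists>p r. D = Circle p r) \<and>
     (\<forall>v\<in>W. perpendicular D (C v)) \<and>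
     (\<forall>v\<in>W. \<forall>w\<in>W. v \<noteq> w \<longrightarrow> gpoints (C v) \<inter> gpoints (C w) \<subseteq> gpoints D)"

definition total_curv_in :: "gcircle \<Rightarrow> gcircle \<Rightarrow> real" where
  "total_curv_in D C = geod_curv C * hlength (gpoints C \<inter> (ginside D \<union> gpoints D))"


section \<open>Triangulated surfaces\<close>

definition closed_surface :: "'a topology \<Rightarrow> bool" where
  "closed_surface X \<longleftrightarrow>
     topspace X \<noteq> {} \<and> compact_space X \<and> connected_space X \<and> Hausdorff_space X \<and>
     (\<forall>x\<in>topspace X. \<exists>U. openin X U \<and> x \<in> U \<and>
        subtopology X U homeomorphic_space (euclidean :: complex topology))"

text \<open>An orientation: a locally coherent choice of generators of the local homology groups.\<close>

definition surface_orientation :: "'a topology \<Rightarrow> ('a \<Rightarrow> 'a chain set) \<Rightarrow> bool" where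
  "surface_orientation X \<mu> \<longleftrightarrow>
     (\<forall>x\<in>topspace X.
        \<mu> x \<in> carrier (relative_homology_group 2 X (topspace X - {x})) \<and>
        generate (relative_homology_group 2 X (topspace X - {x})) {\<mu> x} =
          carrier (relative_homology_group 2 X (topspace X - {x}))) \<and>
     (\<forall>x\<in>topspace X. \<exists>U. openin X U \<and> x \<in> U \<and>
        (\<exists>c \<in> carrier (relative_homology_group 2 X (topspace X - U)).
           \<forall>y\<in>U. hom_induced 2 X (topspace X - U) X (topspace X - {y}) id c = \<mu> y))"

definition closed_oriented_surface :: "nat \<Rightarrow> 'a topology \<Rightarrow> bool" where
  "closed_oriented_surface g X \<longleftrightarrow>
     closed_surface X \<and> (\<exists>\<mu>. surface_orientation X \<mu>) \<and>
     homology_group 1 X \<cong> free_Abelian_group {..<2 * g}"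

text \<open>
  \<open>S\<close> is the closed surface \<open>X\<close> of genus \<open>g\<close> minus \<open>n\<close> open disks (with disjoint closures);
  its boundary is \<open>X frontier_of S\<close>.
\<close>

definition surface_gn :: "nat \<Rightarrow> nat \<Rightarrow> 'a topology \<Rightarrow> 'a set \<Rightarrow> bool" where
  "surface_gn g n X S \<longleftrightarrow>
     closed_oriented_surface g X \<and>
     (\<exists>h :: nat \<Rightarrow> complex \<Rightarrow> 'a.
        (\<forall>i<n. embedding_map (top_of_set (cball 0 1)) X (h i)) \<and>
        (\<forall>i<n. \<forall>j<n. i \<noteq> j \<longrightarrow> h i ` cball 0 1 \<inter> h j ` cball 0 1 = {}) \<and>
        S = topspace X - (\<Union>i<n. h i ` ball 0 1))"

definition model_corners :: "complex set" where
  "model_corners = {0, 1, \<i>}"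

definition model_sides :: "complex set set" where
  "model_sides = {closed_segment a b | a b. a \<in> model_corners \<and> b \<in> model_corners \<and> a \<noteq> b}"

text \<open>
  Faces and edges are closed subsets of \<open>S\<close> and vertices are points of \<open>S\<close>, so that the
  vertices of a face \<open>f\<close> are the elements of \<open>V \<inter> f\<close>. Two faces may share several vertices and
  edges; a simplicial triangulation is the case where they share at most one vertex or one edge.
\<close>

definition triangulation ::
    "'a topology \<Rightarrow> 'a set \<Rightarrow> 'a set \<Rightarrow> 'a set set \<Rightarrow> 'a set set \<Rightarrow> bool" where
  "triangulation X S V E F \<longleftrightarrow>
     finite F \<and> \<Union>F = S \<and> V \<subseteq> S \<and> (\<forall>e\<in>E. \<exists>f\<in>F. e \<subseteq> f) \<and>
     (\<forall>f\<in>F. \<exists>h. embedding_map (top_of_set (convex hull model_corners)) X h \<and>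
        h ` (convex hull model_corners) = f \<and>
        h ` model_corners = V \<inter> f \<and>
        (\<lambda>s. h ` s) ` model_sides = {e \<in> E. e \<subseteq> f}) \<and>
     (\<forall>f\<in>F. \<forall>f'\<in>F. f \<noteq> f' \<longrightarrow>
        f \<inter> f' = \<Union>{e \<in> E. e \<subseteq> f \<and> e \<subseteq> f'} \<union> (V \<inter> f \<inter> f'))"

definition bdry_vertices :: "'a topology \<Rightarrow> 'a set \<Rightarrow> 'a set \<Rightarrow> 'a set" where
  "bdry_vertices X S V = V \<inter> (X frontier_of S)"

definition int_vertices :: "'a topology \<Rightarrow> 'a set \<Rightarrow> 'a set \<Rightarrow> 'a set" where
  "int_vertices X S V = V - (X frontier_of S)"

definition faces_at :: "'a set set \<Rightarrow> 'a set \<Rightarrow> 'a set set" where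
  "faces_at F I = {f \<in> F. \<exists>v\<in>I. v \<in> f}"

definition admissible_total_curvs :: "'a set \<Rightarrow> 'a set set \<Rightarrow> ('a \<Rightarrow> real) set" where
  "admissible_total_curvs Vi F =
     {T. (\<forall>v\<in>Vi. T v > 0) \<and>
         (\<forall>I. I \<noteq> {} \<and> I \<subseteq> Vi \<longrightarrow> (\<Sum>v\<in>I. T v) < pi * real (card (faces_at F I)))}"


section \<open>Generalized circle packings on a surface\<close>

text \<open>
  A packing is recorded by the geodesic curvatures at the vertices and, for every face \<open>f\<close>, a
  representative of the configuration \<open>P(f)\<close> (unique up to isometry) with these curvatures. The
  agreement of the curvatures across faces is what makes the triangles spanned by the centers
  match along common edges, so these data determine the glued conical surface.
\<close>

record 'a packing =
  curv :: "'a \<Rightarrow> real"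
  circ :: "'a set \<Rightarrow> 'a \<Rightarrow> gcircle"
  dual :: "'a set \<Rightarrow> gcircle"

definition circle_packing :: "'a set \<Rightarrow> 'a set set \<Rightarrow> 'a packing \<Rightarrow> bool" where
  "circle_packing V F P \<longleftrightarrow>
     (\<forall>v\<in>V. curv P v > 0) \<and>
     (\<forall>f\<in>F. triangle_packing (V \<inter> f) (circ P f) (dual P f) \<and>
        (\<forall>v \<in> V \<inter> f. geod_curv (circ P f v) = curv P v))"

definition total_curv :: "'a set set \<Rightarrow> 'a packing \<Rightarrow> 'a \<Rightarrow> real" where
  "total_curv F P v = (\<Sum>f \<in> {f \<in> F. v \<in> f}. total_curv_in (dual P f) (circ P f v))"

definition realizes ::
    "'a topology \<Rightarrow> 'a set \<Rightarrow> 'a set \<Rightarrow> 'a set set \<Rightarrow> 'a packing \<Rightarrow>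
     ('a \<Rightarrow> real) \<Rightarrow> ('a \<Rightarrow> real) \<Rightarrow> bool" where
  "realizes X S V F P k T \<longleftrightarrow>
     circle_packing V F P \<and>
     (\<forall>v \<in> bdry_vertices X S V. curv P v = k v) \<and>
     (\<forall>v \<in> int_vertices X S V. total_curv F P v = T v)"

end

theory Submission
  imports Defs
begin

text \<open>
  The total geodesic curvature of the circle of curvature \<open>k\<^sub>1\<close> in a triangle with
  curvatures \<open>k\<^sub>1, k\<^sub>2, k\<^sub>3\<close> is an explicit function of these numbers,
  and it has two monotonicity properties: it decreases when \<open>k\<^sub>2\<close> or
  \<open>k\<^sub>3\<close> grows, and it strictly increases when all three are multiplied by the same
  \<open>l > 1\<close> (together: \<open>face_total_curv_less\<close>). Suppose the ratio of the
  curvatures of the two packings attains a maximum \<open>l > 1\<close> at an interior vertex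
  \<open>v\<close>. In every face at \<open>v\<close> the new curvature at \<open>v\<close> is exactly
  \<open>l\<close> times the old one and the other two are at most \<open>l\<close> times the old
  ones, so the total geodesic curvature at \<open>v\<close> has strictly increased
  (\<open>total_curv_less\<close>). But it was prescribed. This argument is local, and it
  yields the second assertion because the maximum over the finitely many vertices is attained
  somewhere.

  To compute the function, generalized circles are described by vectors \<open>w\<close> of Minkowski
  space: the circle is where the product with \<open>w\<close> is \<open>-1\<close>, and \<open>w\<close>
  has square \<open>1 / k\<^sup>2 - 1\<close> (\<open>gpoints_eq\<close>,
  \<open>mink_cycle_vector_self\<close>). External tangency means that the product of the two
  vectors is \<open>-1 - 1 / (k * l)\<close>, and perpendicularity that it is \<open>-1\<close>. Since the
  space has dimension three, these products determine the curvature \<open>coth R\<close> of the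
  dual circle: \<open>coth\<^sup>2 R = 1 + k\<^sub>1 * k\<^sub>2 + k\<^sub>2 * k\<^sub>3 + k\<^sub>3 * k\<^sub>1\<close>
  (\<open>dual_circle_curvature\<close>). The arc of a circle of curvature \<open>k\<close> inside a
  perpendicular circle of radius \<open>R\<close> has length
  \<open>\<integral> 2 / (1 + (k\<^sup>2 - 1) * t\<^sup>2) dt\<close> over \<open>[0, tanh R]\<close>,
  by a rational parametrization that is common to circles, horocycles and hypercycles
  (\<open>total_curv_in_perpendicular\<close>). In the variable \<open>w = sinh R\<close> the
  total geodesic curvature becomes
  \<open>\<integral> 2 * k / (sqrt (1 + w\<^sup>2) * (1 + k\<^sup>2 * w\<^sup>2)) dw\<close>, from which
  both monotonicity properties are read off.
\<close>

section \<open>Minkowski space and the hyperbolic plane\<close>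

lemma mink_commute: "mink x y = mink y x"
  by (simp add: mink_def inner_commute)

lemma mink_add_left: "mink (x + y) z = mink x z + mink y z"
  and mink_add_right: "mink z (x + y) = mink z x + mink z y"
  and mink_diff_left: "mink (x - y) z = mink x z - mink y z"
  and mink_diff_right: "mink z (x - y) = mink z x - mink z y"
  and mink_scaleR_left: "mink (a *\<^sub>R x) z = a * mink x z"
  and mink_scaleR_right: "mink z (a *\<^sub>R x) = a * mink z x"
  and mink_minus_left: "mink (- x) z = - mink x z"
  and mink_minus_right: "mink z (- x) = - mink z x"
  by (simp_all add: mink_def inner_add_left inner_add_right inner_diff_left inner_diff_right
      algebra_simps)

lemma mink_zero [simp]: "mink 0 z = 0" "mink z 0 = 0"
  by (simp_all add: mink_def)

lemmas mink_bilinear = mink_add_left mink_add_right mink_diff_left mink_diff_right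
  mink_scaleR_left mink_scaleR_right mink_minus_left mink_minus_right

lemma bounded_linear_mink: "bounded_linear (\<lambda>x. mink x z)"
proof -
  have "(\<lambda>x. mink x z) = (\<lambda>x. fst x \<bullet> fst z - snd x * snd z)"
    by (simp add: mink_def)
  then show ?thesis
    by (auto intro!: bounded_linear_sub bounded_linear_inner_left_comp bounded_linear_fst
        bounded_linear_mult_const bounded_linear_snd)
qed

lemma hplane_self: "x \<in> hplane \<Longrightarrow> mink x x = -1"
  by (simp add: hplane_def)

text \<open>
  The reversed Cauchy-Schwarz inequality, which reduces to the Euclidean one in the space component.
\<close>

lemma hplane_mink_le:
  assumes "x \<in> hplane" "y \<in> hplane"
  shows "mink x y \<le> -1"
proof -
  define a b where "a = norm (fst x)" and "b = norm (fst y)"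
  have sx: "(snd x)\<^sup>2 = 1 + a\<^sup>2" and px: "snd x > 0"
    and sy: "(snd y)\<^sup>2 = 1 + b\<^sup>2" and py: "snd y > 0"
    using assms by (auto simp: hplane_def mink_def a_def b_def power2_norm_eq_inner power2_eq_square[of "snd _"])
  have "(1 + a * b)\<^sup>2 \<le> (1 + a\<^sup>2) * (1 + b\<^sup>2)"
    using zero_le_power2[of "a - b"] by (simp add: power2_eq_square algebra_simps)
  also have "\<dots> = (snd x * snd y)\<^sup>2"
    using sx sy by (simp add: power_mult_distrib)
  finally have "1 + a * b \<le> snd x * snd y"
    using px py by (meson power2_le_imp_le less_imp_le mult_pos_pos)
  moreover have "fst x \<bullet> fst y \<le> a * b"
    unfolding a_def b_def by (rule norm_cauchy_schwarz)
  ultimately show ?thesis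
    by (simp add: mink_def)
qed

text \<open>
  Points of the sheet are constructed below as explicit vectors with square \<open>-1\<close>. That
  they lie on the upper sheet is checked against a single known point, since vectors of the two
  sheets have Minkowski product at least \<open>1\<close>.
\<close>

lemma mem_hplane_if_same_sheet:
  assumes "mink z z = -1" "x \<in> hplane" "mink z x \<le> 0"
  shows "z \<in> hplane"
proof (rule ccontr)
  assume "z \<notin> hplane"
  moreover have "snd z \<noteq> 0"
  proof
    assume "snd z = 0"
    then have "fst z \<bullet> fst z = -1" using assms(1) by (simp add: mink_def)
    then show False by (metis inner_ge_zero neg_0_le_iff_le not_one_le_zero)
  qed
  ultimately have "- z \<in> hplane"
    using assms(1) by (auto simp: hplane_def mink_minus_left mink_minus_right)
  from hplane_mink_le[OF this assms(2)] show False
    using assms(3) by (simp add: mink_minus_left)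
qed

lemma hdist_less_iff:
  assumes "x \<in> hplane" "y \<in> hplane" "r > 0"
  shows "hdist x y < r \<longleftrightarrow> - mink x y < cosh r" and "hdist x y = r \<longleftrightarrow> - mink x y = cosh r"
proof -
  have 1: "- mink x y \<ge> 1" using hplane_mink_le[OF assms(1,2)] by simp
  have 2: "cosh r \<ge> 1" by (simp add: cosh_real_ge_1)
  have 3: "arcosh (cosh r) = r" using assms(3) by (simp add: arcosh_cosh_real)
  show "hdist x y < r \<longleftrightarrow> - mink x y < cosh r"
    using arcosh_less_iff_real[OF 1 2] 3 by (simp add: hdist_def)
  show "hdist x y = r \<longleftrightarrow> - mink x y = cosh r"
    using 3 1 by (metis hdist_def cosh_arcosh_real)
qed

text \<open>
  Removing from \<open>x\<close> its component along \<open>n\<close> and normalizing gives the foot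
  of the perpendicular from \<open>x\<close>. Every other point of the geodesic has the same
  product with \<open>x\<close> as with a multiple of that foot, so the reversed Cauchy-Schwarz
  inequality shows that the foot is nearest.
\<close>

lemma hdist_geodesic_eq:
  assumes x: "x \<in> hplane" and n: "mink n n = 1"
  shows "hdist_geodesic x n = arcosh (sqrt (1 + (mink x n)\<^sup>2))"
proof -
  define c where "c = mink x n"
  define m where "m = sqrt (1 + c\<^sup>2)"
  have m1: "m \<ge> 1" and m2: "m\<^sup>2 = 1 + c\<^sup>2" by (auto simp: m_def)
  define y0 where "y0 = (1 / m) *\<^sub>R (x - c *\<^sub>R n)"
  have xx: "mink x x = -1" using x by (rule hplane_self)
  have nx: "mink n x = c" by (simp add: c_def mink_commute)
  have "mink y0 y0 = (1 / m)\<^sup>2 * (- 1 - c\<^sup>2)"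
    unfolding y0_def by (simp add: mink_bilinear xx n c_def[symmetric] nx power2_eq_square algebra_simps)
  also have "\<dots> = (1 / m)\<^sup>2 * - m\<^sup>2" using m2 by simp
  also have "\<dots> = - 1" using m1 by (simp add: power_divide)
  finally have y00: "mink y0 y0 = -1" .
  have y0x: "mink y0 x = - m"
  proof -
    have "mink y0 x = (1 / m) * (- 1 - c\<^sup>2)"
      unfolding y0_def by (simp add: mink_bilinear xx nx power2_eq_square)
    also have "\<dots> = - m\<^sup>2 / m" using m2 by simp
    finally show ?thesis using m1 by (simp add: power2_eq_square)
  qed
  have y0: "y0 \<in> hplane"
    using mem_hplane_if_same_sheet[OF y00 x] y0x m1 by simp
  have y0n: "mink y0 n = 0"
    unfolding y0_def by (simp add: mink_bilinear n c_def)
  have "hdist_geodesic x n = arcosh m"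
    unfolding hdist_geodesic_def
  proof (rule cInf_eq_minimum)
    show "arcosh m \<in> hdist x ` hgeodesic n"
      using y0 y0n y0x by (auto simp: hgeodesic_def hdist_def mink_commute intro!: image_eqI[of _ _ y0])
  next
    fix d assume "d \<in> hdist x ` hgeodesic n"
    then obtain y where y: "y \<in> hplane" "mink y n = 0" "d = hdist x y"
      by (auto simp: hgeodesic_def)
    have "x = m *\<^sub>R y0 + c *\<^sub>R n" using m1 by (simp add: y0_def)
    then have "mink x y = m * mink y0 y"
      using y(2) by (metis mink_add_left mink_scaleR_left mink_commute mult_zero_right add.right_neutral)
    moreover have "mink y0 y \<le> -1" by (rule hplane_mink_le[OF y0 y(1)])
    ultimately have "m \<le> - mink x y"
      using m1 mult_left_mono[of "mink y0 y" "-1" m] by simp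
    then show "arcosh m \<le> d"
      using m1 y(3) by (cases "m = - mink x y") (auto simp: hdist_def intro!: less_imp_le[OF arcosh_real_strict_mono])
  qed
  then show ?thesis by (simp add: m_def c_def)
qed

lemma hdist_geodesic_less_iff:
  assumes x: "x \<in> hplane" and n: "mink n n = 1" and d: "d > 0"
  shows "hdist_geodesic x n < d \<longleftrightarrow> \<bar>mink x n\<bar> < sinh d"
    and "hdist_geodesic x n = d \<longleftrightarrow> \<bar>mink x n\<bar> = sinh d"
proof -
  define c where "c = mink x n"
  have s: "sinh d > 0" using d by simp
  have 1: "sqrt (1 + c\<^sup>2) \<ge> 1" by simp
  have 2: "cosh d = sqrt (1 + (sinh d)\<^sup>2)"
    using cosh_square_eq[of d] cosh_real_nonneg[of d] by (metis real_sqrt_unique add.commute)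
  have "hdist_geodesic x n < d \<longleftrightarrow> arcosh (sqrt (1 + c\<^sup>2)) < arcosh (cosh d)"
    using d by (simp add: hdist_geodesic_eq[OF x n] c_def arcosh_cosh_real)
  also have "\<dots> \<longleftrightarrow> sqrt (1 + c\<^sup>2) < cosh d"
    by (rule arcosh_less_iff_real[OF 1 cosh_real_ge_1])
  also have "\<dots> \<longleftrightarrow> c\<^sup>2 < (sinh d)\<^sup>2" unfolding 2 by simp
  also have "\<dots> \<longleftrightarrow> \<bar>c\<bar> < sinh d"
    using s abs_square_less_1 by (metis abs_le_square_iff abs_of_pos not_le)
  finally show "hdist_geodesic x n < d \<longleftrightarrow> \<bar>mink x n\<bar> < sinh d" by (simp add: c_def)
  have "hdist_geodesic x n = d \<longleftrightarrow> sqrt (1 + c\<^sup>2) = cosh d"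
    using d 1 by (metis hdist_geodesic_eq[OF x n] c_def arcosh_cosh_real cosh_arcosh_real less_imp_le)
  also have "\<dots> \<longleftrightarrow> c\<^sup>2 = (sinh d)\<^sup>2" unfolding 2 by simp
  also have "\<dots> \<longleftrightarrow> \<bar>c\<bar> = sinh d" using s by (metis abs_of_pos power2_eq_iff_nonneg abs_ge_zero power2_abs)
  finally show "hdist_geodesic x n = d \<longleftrightarrow> \<bar>mink x n\<bar> = sinh d" by (simp add: c_def)
qed

section \<open>Generalized circles as plane sections\<close>

text \<open>
  The three kinds of generalized circles become one: each is the section of the sheet by the plane
  where the product with its cycle vector is \<open>-1\<close>. The type is only visible in the
  square of the vector, which is \<open>1 / k\<^sup>2 - 1\<close> and hence timelike, null or
  spacelike.
\<close>

fun cycle_vector :: "gcircle \<Rightarrow> mvec" where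
  "cycle_vector (Circle p r) = (1 / cosh r) *\<^sub>R p"
| "cycle_vector (Horocycle u) = u"
| "cycle_vector (Hypercycle n d) = (1 / sinh d) *\<^sub>R n"

lemma geod_curv_pos: "gcircle_ok C \<Longrightarrow> geod_curv C > 0"
  by (cases C) auto

lemma mink_cycle_vector_self:
  assumes "gcircle_ok C"
  shows "mink (cycle_vector C) (cycle_vector C) = (1 / geod_curv C)\<^sup>2 - 1"
proof (cases C)
  case (Circle p r)
  then have "mink p p = -1" using assms by (auto simp: hplane_def)
  moreover have "(sinh r)\<^sup>2 = (cosh r)\<^sup>2 - 1" by (simp add: cosh_square_eq)
  ultimately show ?thesis using Circle
    by (simp add: mink_bilinear tanh_def power_divide diff_divide_distrib) (simp add: power2_eq_square)
next
  case (Horocycle u)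
  then show ?thesis using assms by simp
next
  case (Hypercycle n d)
  then have "mink n n = 1" "sinh d > 0" using assms by auto
  moreover have "(cosh d)\<^sup>2 = (sinh d)\<^sup>2 + 1" by (rule cosh_square_eq)
  moreover have "cosh d > 0" by simp
  ultimately show ?thesis using Hypercycle
    by (simp add: mink_bilinear tanh_def power_divide field_simps power2_eq_square)
qed

lemma gpoints_eq:
  assumes "gcircle_ok C"
  shows "gpoints C = {x \<in> hplane. mink x (cycle_vector C) = -1}"
proof (cases C)
  case (Circle p r)
  have c: "cosh r > 0" and p: "p \<in> hplane" "r > 0" using assms Circle by simp_all
  have "hdist p x = r \<longleftrightarrow> mink x (cycle_vector C) = -1" if "x \<in> hplane" for x
    using hdist_less_iff[OF p(1) that p(2)] c Circle
    by (auto simp: mink_bilinear mink_commute[of _ p] field_simps)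
  then show ?thesis using Circle by auto
next
  case (Horocycle u)
  then show ?thesis by simp
next
  case (Hypercycle n d)
  have s: "sinh d > 0" and n: "mink n n = 1" "d > 0" using assms Hypercycle by simp_all
  have "mink x n < 0 \<and> hdist_geodesic x n = d \<longleftrightarrow> mink x (cycle_vector C) = -1"
    if "x \<in> hplane" for x
    using hdist_geodesic_less_iff[OF that n] s Hypercycle by (auto simp: mink_bilinear field_simps)
  then show ?thesis using Hypercycle by auto
qed

lemma ginside_eq:
  assumes "gcircle_ok C"
  shows "ginside C = {x \<in> hplane. mink x (cycle_vector C) > -1}"
proof (cases C)
  case (Circle p r)
  have c: "cosh r > 0" and p: "p \<in> hplane" "r > 0" using assms Circle by simp_all
  have "hdist p x < r \<longleftrightarrow> mink x (cycle_vector C) > -1" if "x \<in> hplane" for x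
    using hdist_less_iff[OF p(1) that p(2)] c Circle
    by (auto simp: mink_bilinear mink_commute[of _ p] field_simps)
  then show ?thesis using Circle by auto
next
  case (Horocycle u)
  then show ?thesis by simp
next
  case (Hypercycle n d)
  have s: "sinh d > 0" and n: "mink n n = 1" "d > 0" using assms Hypercycle by simp_all
  have "mink x n \<ge> 0 \<or> hdist_geodesic x n < d \<longleftrightarrow> mink x (cycle_vector C) > -1"
    if "x \<in> hplane" for x
    using hdist_geodesic_less_iff(1)[OF that n] s Hypercycle less_le_trans[of "- sinh d" 0 "mink x n"]
    by (auto simp: mink_bilinear field_simps)
  then show ?thesis using Hypercycle by auto
qed

section \<open>Orthonormal frames and parametrized cycles\<close>

definition frame :: "mvec \<Rightarrow> mvec \<Rightarrow> mvec \<Rightarrow> bool" where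
  "frame x e \<nu> \<longleftrightarrow> x \<in> hplane \<and> mink e e = 1 \<and> mink \<nu> \<nu> = 1 \<and>
     mink x e = 0 \<and> mink x \<nu> = 0 \<and> mink e \<nu> = 0"

lemma frame_mink:
  assumes "frame x e \<nu>"
  shows "mink x x = -1" "mink e e = 1" "mink \<nu> \<nu> = 1" "mink x e = 0" "mink e x = 0"
    "mink x \<nu> = 0" "mink \<nu> x = 0" "mink e \<nu> = 0" "mink \<nu> e = 0" "x \<in> hplane"
  using assms mink_commute[of e x] mink_commute[of \<nu> x] mink_commute[of \<nu> e]
  by (auto simp: frame_def hplane_def)

lemma frame_exists:
  assumes x: "x \<in> hplane" and n: "mink \<nu> \<nu> = 1" "mink x \<nu> = 0"
  shows "\<exists>e. frame x e \<nu>"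
proof -
  define a1 a2 a0 where "a1 = Re (fst x)" and "a2 = Im (fst x)" and "a0 = snd x"
  define b1 b2 b0 where "b1 = Re (fst \<nu>)" and "b2 = Im (fst \<nu>)" and "b0 = snd \<nu>"
  \<comment> \<open>The Lorentzian cross product of \<open>x\<close> and \<open>\<nu>\<close>; its square is given by the
    Lagrange identity.\<close>
  define e :: mvec where
    "e = (Complex (a2 * b0 - a0 * b2) (a0 * b1 - a1 * b0), - (a1 * b2 - a2 * b1))"
  note d = a1_def a2_def a0_def b1_def b2_def b0_def
  have xx: "a1 * a1 + a2 * a2 - a0 * a0 = -1"
    using hplane_self[OF x] by (simp add: mink_def inner_complex_def d)
  have nn: "b1 * b1 + b2 * b2 - b0 * b0 = 1"
    using n(1) by (simp add: mink_def inner_complex_def d)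
  have xn: "a1 * b1 + a2 * b2 - a0 * b0 = 0"
    using n(2) by (simp add: mink_def inner_complex_def d)
  have "mink e e = (a1 * b1 + a2 * b2 - a0 * b0)\<^sup>2
      - (a1 * a1 + a2 * a2 - a0 * a0) * (b1 * b1 + b2 * b2 - b0 * b0)"
    by (simp add: mink_def inner_complex_def e_def power2_eq_square algebra_simps)
  then have "mink e e = 1" by (simp add: xx nn xn)
  moreover have "mink x e = 0"
    by (simp add: mink_def inner_complex_def e_def d algebra_simps)
  moreover have "mink e \<nu> = 0"
    by (simp add: mink_def inner_complex_def e_def d algebra_simps)
  ultimately have "frame x e \<nu>" using x n by (simp add: frame_def)
  then show ?thesis ..
qed

text \<open>
  Three pairwise Minkowski-orthogonal vectors of nonzero square are linearly independent, hence a
  basis of the three-dimensional space.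
\<close>

lemma frame_expansion:
  assumes "frame x e \<nu>"
  shows "y = (- mink y x) *\<^sub>R x + mink y e *\<^sub>R e + mink y \<nu> *\<^sub>R \<nu>"
proof -
  note m = frame_mink[OF assms]
  have ne: "x \<noteq> e" "x \<noteq> \<nu>" "e \<noteq> \<nu>" using m by auto
  have "\<nu> \<noteq> 0" using m(3) by auto
  moreover have "e \<noteq> c *\<^sub>R \<nu>" for c
  proof
    assume "e = c *\<^sub>R \<nu>"
    then have "mink e e = c * mink \<nu> e" by (metis mink_scaleR_left)
    then show False using m by simp
  qed
  moreover have "x - a *\<^sub>R e \<noteq> c *\<^sub>R \<nu>" for a c
  proof
    assume "x - a *\<^sub>R e = c *\<^sub>R \<nu>"
    then have "mink (x - a *\<^sub>R e) x = mink (c *\<^sub>R \<nu>) x" by simp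
    then show False using m by (simp add: mink_bilinear)
  qed
  ultimately have "independent {x, e, \<nu>}"
    using ne by (auto simp: independent_insert span_breakdown_eq)
  moreover have "card {x, e, \<nu>} = 3" using ne by simp
  ultimately have "UNIV \<subseteq> span {x, e, \<nu>}"
    by (intro card_ge_dim_independent) (auto simp: dim_UNIV)
  then have "y \<in> span {x, e, \<nu>}" by auto
  then obtain a b c where y: "y = a *\<^sub>R x + b *\<^sub>R e + c *\<^sub>R \<nu>"
    by (auto simp: span_breakdown_eq algebra_simps eq_diff_eq)
  show ?thesis unfolding y by (simp add: mink_bilinear m)
qed

text \<open>
  A cycle is a conic, so the lines through one of its points \<open>x\<close> in its plane
  parametrize it rationally. Here \<open>e\<close> is the tangent and \<open>\<nu>\<close> the
  inner normal at \<open>x\<close>, so that the plane is spanned by \<open>e\<close> and the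
  acceleration \<open>x + k *\<^sub>R \<nu>\<close>, and \<open>t\<close> is the slope of
  the line. The formula serves circles, horocycles and hypercycles alike.
\<close>

definition cycle_param :: "mvec \<Rightarrow> mvec \<Rightarrow> mvec \<Rightarrow> real \<Rightarrow> real \<Rightarrow> mvec" where
  "cycle_param x e \<nu> k t = x + (1 / (1 + (k\<^sup>2 - 1) * t\<^sup>2)) *\<^sub>R
     ((2 * t) *\<^sub>R e + (2 * t\<^sup>2) *\<^sub>R (x + k *\<^sub>R \<nu>))"

lemma denominator_pos:
  fixes k t :: real
  assumes "\<bar>t\<bar> < 1"
  shows "1 + (k\<^sup>2 - 1) * t\<^sup>2 > 0"
proof -
  have "t\<^sup>2 < 1" using assms by (simp add: abs_square_less_1)
  moreover have "0 \<le> k\<^sup>2 * t\<^sup>2" by simp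
  ultimately have "0 < (1 - t\<^sup>2) + k\<^sup>2 * t\<^sup>2" by linarith
  then show ?thesis by (simp add: algebra_simps)
qed

lemma cycle_param_mem:
  assumes fr: "frame x e \<nu>" and C: "gcircle_ok C"
    and w: "cycle_vector C = x + (1 / geod_curv C) *\<^sub>R \<nu>" and t: "\<bar>t\<bar> < 1"
  shows "cycle_param x e \<nu> (geod_curv C) t \<in> gpoints C"
proof -
  define k where "k = geod_curv C"
  define q where "q = 1 + (k\<^sup>2 - 1) * t\<^sup>2"
  define y where "y = cycle_param x e \<nu> k t"
  note m = frame_mink[OF fr]
  have k: "k > 0" using geod_curv_pos[OF C] by (simp add: k_def)
  have q: "q > 0" using denominator_pos[OF t] by (simp add: q_def)
  have y: "y = x + (2 * t / q) *\<^sub>R e + (2 * t\<^sup>2 / q) *\<^sub>R (x + k *\<^sub>R \<nu>)"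
    by (simp add: y_def cycle_param_def q_def algebra_simps)
  have "mink y y = -1 + (4 * t\<^sup>2 / q\<^sup>2) * (1 + (k\<^sup>2 - 1) * t\<^sup>2 - q)"
    unfolding y using q by (simp add: mink_bilinear m power2_eq_square field_simps)
  then have "mink y y = -1" by (simp add: q_def)
  moreover have "mink y x \<le> 0"
  proof -
    have "mink y x = -1 - 2 * t\<^sup>2 / q" unfolding y by (simp add: mink_bilinear m)
    moreover have "2 * t\<^sup>2 / q \<ge> 0" using q by simp
    ultimately show ?thesis by linarith
  qed
  moreover have "mink y (cycle_vector C) = -1"
    unfolding y w k_def[symmetric] using k by (simp add: mink_bilinear m)
  ultimately show ?thesis
    using mem_hplane_if_same_sheet[of y x] m(10) by (simp add: gpoints_eq[OF C] y_def k_def)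
qed

lemma cycle_param_0 [simp]: "cycle_param x e \<nu> k 0 = x"
  by (simp add: cycle_param_def)

lemma cycle_param_has_vector_derivative:
  assumes "\<bar>t\<bar> < 1"
  shows "(cycle_param x e \<nu> k has_vector_derivative
     (2 / (1 + (k\<^sup>2 - 1) * t\<^sup>2)\<^sup>2) *\<^sub>R ((1 - (k\<^sup>2 - 1) * t\<^sup>2) *\<^sub>R e + (2 * t) *\<^sub>R (x + k *\<^sub>R \<nu>))) (at t)"
proof -
  have q: "1 + (k\<^sup>2 - 1) * t\<^sup>2 \<noteq> 0" using denominator_pos[OF assms, of k] by simp
  have "((\<lambda>t. 2 * t / (1 + (k\<^sup>2 - 1) * t\<^sup>2)) has_real_derivative
      2 * (1 - (k\<^sup>2 - 1) * t\<^sup>2) / (1 + (k\<^sup>2 - 1) * t\<^sup>2)\<^sup>2) (at t)"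
    by (rule derivative_eq_intros refl q)+ (simp add: power2_eq_square algebra_simps)
  moreover have "((\<lambda>t. 2 * t\<^sup>2 / (1 + (k\<^sup>2 - 1) * t\<^sup>2)) has_real_derivative
      4 * t / (1 + (k\<^sup>2 - 1) * t\<^sup>2)\<^sup>2) (at t)"
    by (rule derivative_eq_intros refl q)+ (simp add: power2_eq_square algebra_simps)
  ultimately have "((\<lambda>t. (2 * t / (1 + (k\<^sup>2 - 1) * t\<^sup>2)) *\<^sub>R e
      + (2 * t\<^sup>2 / (1 + (k\<^sup>2 - 1) * t\<^sup>2)) *\<^sub>R (x + k *\<^sub>R \<nu>)) has_vector_derivative
      (2 * (1 - (k\<^sup>2 - 1) * t\<^sup>2) / (1 + (k\<^sup>2 - 1) * t\<^sup>2)\<^sup>2) *\<^sub>R e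
      + (4 * t / (1 + (k\<^sup>2 - 1) * t\<^sup>2)\<^sup>2) *\<^sub>R (x + k *\<^sub>R \<nu>)) (at t)"
    unfolding has_real_derivative_iff_has_vector_derivative
    by (intro has_vector_derivative_add bounded_linear.has_vector_derivative[OF bounded_linear_scaleR_left])
  from has_vector_derivative_add[OF has_vector_derivative_const[of x] this]
  have "((\<lambda>t. x + ((2 * t / (1 + (k\<^sup>2 - 1) * t\<^sup>2)) *\<^sub>R e
      + (2 * t\<^sup>2 / (1 + (k\<^sup>2 - 1) * t\<^sup>2)) *\<^sub>R (x + k *\<^sub>R \<nu>))) has_vector_derivative
      (2 * (1 - (k\<^sup>2 - 1) * t\<^sup>2) / (1 + (k\<^sup>2 - 1) * t\<^sup>2)\<^sup>2) *\<^sub>R e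
      + (4 * t / (1 + (k\<^sup>2 - 1) * t\<^sup>2)\<^sup>2) *\<^sub>R (x + k *\<^sub>R \<nu>)) (at t)" by simp
  moreover have "cycle_param x e \<nu> k = (\<lambda>t. x + ((2 * t / (1 + (k\<^sup>2 - 1) * t\<^sup>2)) *\<^sub>R e
      + (2 * t\<^sup>2 / (1 + (k\<^sup>2 - 1) * t\<^sup>2)) *\<^sub>R (x + k *\<^sub>R \<nu>)))"
    by (simp add: cycle_param_def scaleR_add_right fun_eq_iff add.assoc)
  ultimately show ?thesis
    by (simp add: scaleR_add_right mult_ac)
qed

section \<open>Tangency and perpendicularity in terms of cycle vectors\<close>

text \<open>
  The curves in the definition of tangent vectors are defined on all of the line, while the
  parametrization stays in the cycle only near \<open>0\<close>; it is continued by a constant.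
\<close>

lemma tangent_vector_frame:
  assumes fr: "frame x e \<nu>" and C: "gcircle_ok C"
    and w: "cycle_vector C = x + (1 / geod_curv C) *\<^sub>R \<nu>"
  shows "2 *\<^sub>R e \<in> tangent_vectors (gpoints C) x"
proof -
  define \<gamma> where "\<gamma> = (\<lambda>t. if \<bar>t\<bar> < 1 then cycle_param x e \<nu> (geod_curv C) t else x)"
  have x: "x \<in> gpoints C" using cycle_param_mem[OF fr C w, of 0] by simp
  have "\<gamma> t \<in> gpoints C" for t
    using cycle_param_mem[OF fr C w] x by (auto simp: \<gamma>_def)
  moreover have "\<gamma> 0 = x" by (simp add: \<gamma>_def)
  moreover have "(\<gamma> has_vector_derivative 2 *\<^sub>R e) (at 0)"
  proof (rule has_vector_derivative_transform_within_open)
    show "(cycle_param x e \<nu> (geod_curv C) has_vector_derivative 2 *\<^sub>R e) (at 0)"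
      using cycle_param_has_vector_derivative[of 0 x e \<nu> "geod_curv C"] by simp
    show "open {-1<..<1::real}" by simp
  qed (auto simp: \<gamma>_def)
  ultimately show ?thesis by (auto simp: tangent_vectors_def)
qed

lemma tangent_vector_orthogonal:
  assumes C: "gcircle_ok C" and v: "v \<in> tangent_vectors (gpoints C) x"
  shows "mink v (cycle_vector C) = 0"
proof -
  obtain \<gamma> where \<gamma>: "\<And>t. \<gamma> t \<in> gpoints C" "(\<gamma> has_vector_derivative v) (at 0)"
    using v by (auto simp: tangent_vectors_def)
  have "((\<lambda>t. mink (\<gamma> t) (cycle_vector C)) has_vector_derivative mink v (cycle_vector C)) (at 0)"
    by (rule bounded_linear.has_vector_derivative[OF bounded_linear_mink \<gamma>(2)])
  moreover have "(\<lambda>t. mink (\<gamma> t) (cycle_vector C)) = (\<lambda>t. -1)"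
    using \<gamma>(1) by (auto simp: gpoints_eq[OF C])
  ultimately show ?thesis
    by (metis has_vector_derivative_const vector_derivative_unique_at)
qed

text \<open>
  The normal is \<open>k *\<^sub>R (w - x)\<close>: since \<open>w\<close> has product
  \<open>-1\<close> with \<open>x\<close>, its component along \<open>x\<close> is
  \<open>x\<close> itself, and the square of \<open>w\<close> fixes the length of the rest.
\<close>

lemma gcircle_frame:
  assumes C: "gcircle_ok C" and x: "x \<in> gpoints C"
  shows "\<exists>e \<nu>. frame x e \<nu> \<and> cycle_vector C = x + (1 / geod_curv C) *\<^sub>R \<nu>"
proof -
  define k w \<nu> where "k = geod_curv C" and "w = cycle_vector C" and "\<nu> = k *\<^sub>R (w - x)"
  have k: "k > 0" using geod_curv_pos[OF C] by (simp add: k_def)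
  have xh: "x \<in> hplane" "mink x w = -1" using x by (auto simp: gpoints_eq[OF C] w_def)
  have ww: "mink w w = (1 / k)\<^sup>2 - 1"
    using mink_cycle_vector_self[OF C] by (simp add: w_def k_def)
  have "mink \<nu> \<nu> = 1" 
    using k ww xh(2) hplane_self[OF xh(1)] mink_commute[of w x]
    by (simp add: \<nu>_def mink_bilinear power_divide power2_eq_square)
  moreover have "mink x \<nu> = 0"
    using xh(2) hplane_self[OF xh(1)] by (simp add: \<nu>_def mink_bilinear)
  ultimately obtain e where "frame x e \<nu>" using frame_exists[OF xh(1)] by blast
  moreover have "w = x + (1 / k) *\<^sub>R \<nu>" using k by (simp add: \<nu>_def)
  ultimately show ?thesis unfolding w_def k_def by blast
qed

text \<open>
  The common tangent forces both cycle vectors to differ from \<open>x\<close> by multiples of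
  the same normal, of lengths \<open>1 / k\<close> and \<open>1 / l\<close>. Disjointness of the
  convex sides decides that the multiples have opposite signs.
\<close>

lemma externally_tangent_frame:
  assumes C: "gcircle_ok C" and D: "gcircle_ok D" and tan: "externally_tangent C D"
  shows "\<exists>x e \<nu>. frame x e \<nu> \<and> cycle_vector C = x + (1 / geod_curv C) *\<^sub>R \<nu> \<and>
    cycle_vector D = x - (1 / geod_curv D) *\<^sub>R \<nu>"
proof -
  define k l where "k = geod_curv C" and "l = geod_curv D"
  have k: "k > 0" and l: "l > 0" using geod_curv_pos C D by (auto simp: k_def l_def)
  obtain x where x: "x \<in> gpoints C" "x \<in> gpoints D"
    and tv: "tangent_vectors (gpoints C) x = tangent_vectors (gpoints D) x"
    using tan by (auto simp: externally_tangent_def)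
  obtain e \<nu> where fr: "frame x e \<nu>" and w: "cycle_vector C = x + (1 / k) *\<^sub>R \<nu>"
    using gcircle_frame[OF C x(1)] by (auto simp: k_def)
  note m = frame_mink[OF fr]
  define u where "u = cycle_vector D"
  define a where "a = mink u \<nu>"
  have "2 *\<^sub>R e \<in> tangent_vectors (gpoints D) x"
    using tangent_vector_frame[OF fr C] w tv by (simp add: k_def)
  from tangent_vector_orthogonal[OF D this] have "mink u e = 0"
    by (simp add: mink_bilinear u_def mink_commute)
  moreover have "mink u x = -1"
    using x(2) by (simp add: gpoints_eq[OF D] u_def mink_commute)
  ultimately have u: "u = x + a *\<^sub>R \<nu>"
    using frame_expansion[OF fr, of u] by (simp add: a_def)
  have "mink u u = (1 / l)\<^sup>2 - 1" using mink_cycle_vector_self[OF D] by (simp add: u_def l_def)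
  then have "a\<^sup>2 = (1 / l)\<^sup>2" unfolding u by (simp add: mink_bilinear m power2_eq_square)
  then have "a = 1 / l \<or> a = - (1 / l)" by (simp add: power2_eq_iff)
  moreover have "a \<noteq> 1 / l"
  proof
    assume a: "a = 1 / l"
    \<comment> \<open>With equal signs, points slightly off \<open>x\<close> in the direction \<open>\<nu>\<close> are inside both.\<close>
    define b where "b = min (1 / k) (1 / l)"
    \<comment> \<open>\<open>s\<close> is the hyperbolic tangent of half the distance from \<open>x\<close> to the point \<open>y\<close>;
      being smaller than both \<open>1 / k\<close> and \<open>1 / l\<close> is the condition for \<open>y\<close> to be inside\<close>
    define s where "s = b / (1 + b)"
    have b: "b > 0" "b \<le> 1 / k" "b \<le> 1 / l" using k l by (auto simp: b_def)
    have s: "s > 0" "s < 1" "s < b" using b by (auto simp: s_def field_simps)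
    have s2: "1 - s\<^sup>2 > 0" using s by (simp add: abs_square_less_1)
    define y where "y = (1 / (1 - s\<^sup>2)) *\<^sub>R ((1 + s\<^sup>2) *\<^sub>R x + (2 * s) *\<^sub>R \<nu>)"
    have "mink y y = (1 / (1 - s\<^sup>2))\<^sup>2 * (4 * s\<^sup>2 - (1 + s\<^sup>2)\<^sup>2)"
      unfolding y_def mink_scaleR_left mink_scaleR_right
      by (simp add: mink_bilinear m power2_eq_square) (simp add: algebra_simps)
    also have "4 * s\<^sup>2 - (1 + s\<^sup>2)\<^sup>2 = - ((1 - s\<^sup>2)\<^sup>2)" by (simp add: power2_eq_square algebra_simps)
    finally have "mink y y = -1" using s2 by (simp add: power_divide)
    moreover have "mink y x \<le> 0"
    proof -
      have "mink y x = (1 / (1 - s\<^sup>2)) * - (1 + s\<^sup>2)"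
        by (simp only: y_def mink_scaleR_left mink_add_left m) simp
      also have "\<dots> \<le> 0" using s2 zero_le_power2[of s] by (intro mult_nonneg_nonpos) (simp, linarith)
      finally show ?thesis .
    qed
    ultimately have y: "y \<in> hplane" using mem_hplane_if_same_sheet m(10) by blast
    have ins: "mink y (x + c *\<^sub>R \<nu>) > -1" if "c \<ge> b" for c
    proof -
      have "mink ((1 + s\<^sup>2) *\<^sub>R x + (2 * s) *\<^sub>R \<nu>) (x + c *\<^sub>R \<nu>) = 2 * s * c - (1 + s\<^sup>2)"
        by (simp add: mink_bilinear m)
      then have "mink y (x + c *\<^sub>R \<nu>) = (1 / (1 - s\<^sup>2)) * (2 * s * c - (1 + s\<^sup>2))"
        by (simp only: y_def mink_scaleR_left)
      moreover have "2 * s * c > 2 * s\<^sup>2" using s that by (simp add: power2_eq_square)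
      moreover have "(1 / (1 - s\<^sup>2)) * (2 * s\<^sup>2 - (1 + s\<^sup>2)) = -1"
        using s2 by (simp add: divide_eq_eq)
      ultimately show ?thesis
        using s2 mult_strict_left_mono[of "2 * s\<^sup>2 - (1 + s\<^sup>2)" "2 * s * c - (1 + s\<^sup>2)" "1 / (1 - s\<^sup>2)"]
        by simp
    qed
    have "y \<in> ginside C" using y ins[OF b(2)] by (simp add: ginside_eq[OF C] w)
    moreover have "y \<in> ginside D"
      using y ins[OF b(3)] u a by (simp add: ginside_eq[OF D] u_def)
    ultimately show False using tan by (auto simp: externally_tangent_def)
  qed
  ultimately have "cycle_vector D = x - (1 / l) *\<^sub>R \<nu>" using u by (auto simp: u_def)
  then show ?thesis using fr w unfolding k_def l_def by blast
qed

text \<open>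
  In the tangent plane at a common point the normal of \<open>D\<close> is a tangent of
  \<open>C\<close>. It serves as \<open>e\<close>, which therefore points into \<open>D\<close>.
\<close>

lemma perpendicular_frame:
  assumes C: "gcircle_ok C" and D: "gcircle_ok D" and perp: "perpendicular D C"
  shows "\<exists>x e \<nu>. frame x e \<nu> \<and> cycle_vector C = x + (1 / geod_curv C) *\<^sub>R \<nu> \<and>
    cycle_vector D = x + (1 / geod_curv D) *\<^sub>R e"
proof -
  obtain x where x: "x \<in> gpoints C" "x \<in> gpoints D"
    and tv: "\<And>v w. v \<in> tangent_vectors (gpoints D) x \<Longrightarrow> w \<in> tangent_vectors (gpoints C) x \<Longrightarrow> mink v w = 0"
    using perp by (auto simp: perpendicular_def)
  obtain e \<nu> where fr: "frame x e \<nu>" and w: "cycle_vector C = x + (1 / geod_curv C) *\<^sub>R \<nu>"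
    using gcircle_frame[OF C x(1)] by auto
  obtain e' \<nu>' where fr': "frame x e' \<nu>'" and w': "cycle_vector D = x + (1 / geod_curv D) *\<^sub>R \<nu>'"
    using gcircle_frame[OF D x(2)] by auto
  note m = frame_mink[OF fr] and m' = frame_mink[OF fr']
  have "mink e' e = 0"
    using tv[OF tangent_vector_frame[OF fr' D w'] tangent_vector_frame[OF fr C w]]
    by (simp add: mink_bilinear)
  then have e': "e' = mink e' \<nu> *\<^sub>R \<nu>" using frame_expansion[OF fr, of e'] m' by simp
  define c where "c = mink e' \<nu>"
  have e'c: "e' = c *\<^sub>R \<nu>" using e' by (simp add: c_def)
  have "c \<noteq> 0" using m'(2) unfolding e'c by (auto simp: mink_bilinear)
  moreover have "mink \<nu>' e' = 0" using m' by simp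
  ultimately have "mink \<nu>' \<nu> = 0" unfolding e'c by (simp add: mink_bilinear)
  then have n': "\<nu>' = mink \<nu>' e *\<^sub>R e" using frame_expansion[OF fr, of \<nu>'] m' by simp
  define d where "d = mink \<nu>' e"
  have n'd: "\<nu>' = d *\<^sub>R e" using n' by (simp add: d_def)
  have "frame x \<nu>' \<nu>" using fr m' unfolding frame_def n'd
    by (auto simp: mink_bilinear)
  then show ?thesis using w w' by blast
qed

lemma mink_externally_tangent:
  assumes C: "gcircle_ok C" and D: "gcircle_ok D" and tan: "externally_tangent C D"
  shows "mink (cycle_vector C) (cycle_vector D) = - 1 - 1 / (geod_curv C * geod_curv D)"
proof -
  obtain x e \<nu> where fr: "frame x e \<nu>" and w: "cycle_vector C = x + (1 / geod_curv C) *\<^sub>R \<nu>"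
    "cycle_vector D = x - (1 / geod_curv D) *\<^sub>R \<nu>"
    using externally_tangent_frame[OF assms] by blast
  show ?thesis unfolding w by (simp add: mink_bilinear frame_mink[OF fr])
qed

lemma mink_perpendicular:
  assumes C: "gcircle_ok C" and D: "gcircle_ok D" and perp: "perpendicular D C"
  shows "mink (cycle_vector D) (cycle_vector C) = - 1"
proof -
  obtain x e \<nu> where fr: "frame x e \<nu>" and w: "cycle_vector C = x + (1 / geod_curv C) *\<^sub>R \<nu>"
    "cycle_vector D = x + (1 / geod_curv D) *\<^sub>R e"
    using perpendicular_frame[OF assms] by blast
  show ?thesis unfolding w by (simp add: mink_bilinear frame_mink[OF fr])
qed

section \<open>The length of an arc cut out by the dual circle\<close>

text \<open>
  The integrand is the speed of the rational parametrization, so this is the length along a cycle of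
  curvature \<open>k\<close> from the base point to the point of slope \<open>\<tau>\<close>.
\<close>

definition arc_length :: "real \<Rightarrow> real \<Rightarrow> real" where
  "arc_length k \<tau> = integral {0..\<tau>} (\<lambda>t. 2 / (1 + (k\<^sup>2 - 1) * t\<^sup>2))"

text \<open>
  The integrand is regular on \<open>(-1, 1)\<close> for every \<open>k\<close>, whereas its
  antiderivative is an arctangent, a linear function or an area hyperbolic tangent. Working with
  an abstract antiderivative avoids the distinction.
\<close>

lemma arc_length_antiderivative:
  "\<exists>G. (\<forall>t. \<bar>t\<bar> < 1 \<longrightarrow> (G has_real_derivative 2 / (1 + (k\<^sup>2 - 1) * t\<^sup>2)) (at t)) \<and>
    (\<forall>\<tau>. 0 \<le> \<tau> \<and> \<tau> < 1 \<longrightarrow> arc_length k \<tau> = G \<tau> - G 0)"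
proof -
  let ?g = "\<lambda>t::real. 2 / (1 + (k\<^sup>2 - 1) * t\<^sup>2)"
  have "isCont ?g t" if "ereal (-1) < ereal t" "ereal t < ereal 1" for t
  proof -
    have "\<bar>t\<bar> < 1" using that by simp
    then have "1 + (k\<^sup>2 - 1) * t\<^sup>2 \<noteq> 0" using denominator_pos[of t k] by simp
    then show ?thesis by (intro continuous_intros) auto
  qed
  then have "\<exists>G. \<forall>t. ereal (-1) < ereal t \<longrightarrow> ereal t < ereal 1 \<longrightarrow> (G has_vector_derivative ?g t) (at t)"
    by (intro einterval_antiderivative) auto
  then obtain G where "\<forall>t. ereal (-1) < ereal t \<longrightarrow> ereal t < ereal 1 \<longrightarrow> (G has_vector_derivative ?g t) (at t)" ..
  then have G: "(G has_vector_derivative ?g t) (at t)" if "\<bar>t\<bar> < 1" for t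
    using that by (auto simp: abs_less_iff)
  have "arc_length k \<tau> = G \<tau> - G 0" if "0 \<le> \<tau>" "\<tau> < 1" for \<tau>
    unfolding arc_length_def
    by (intro integral_unique fundamental_theorem_of_calculus)
      (use that in \<open>auto intro!: has_vector_derivative_at_within[OF G]\<close>)
  then show ?thesis using G by (auto simp: has_real_derivative_iff_has_vector_derivative)
qed

text \<open>
  The vectors \<open>e\<close> and \<open>x + k *\<^sub>R \<nu>\<close> are orthogonal with
  squares \<open>1\<close> and \<open>k\<^sup>2 - 1\<close>, so the numerator is again the square of the
  denominator of the parametrization.
\<close>

lemma mink_cycle_param_velocity:
  fixes k t :: real
  assumes fr: "frame x e \<nu>" and t: "\<bar>t\<bar> < 1"
  defines "v \<equiv> (2 / (1 + (k\<^sup>2 - 1) * t\<^sup>2)\<^sup>2) *\<^sub>R ((1 - (k\<^sup>2 - 1) * t\<^sup>2) *\<^sub>R e + (2 * t) *\<^sub>R (x + k *\<^sub>R \<nu>))"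
  shows "mink v v = (2 / (1 + (k\<^sup>2 - 1) * t\<^sup>2))\<^sup>2"
proof -
  note m = frame_mink[OF fr]
  define q where "q = 1 + (k\<^sup>2 - 1) * t\<^sup>2"
  have q: "q > 0" using denominator_pos[OF t] by (simp add: q_def)
  have "mink v v = (2 / q\<^sup>2)\<^sup>2 * ((1 - (k\<^sup>2 - 1) * t\<^sup>2)\<^sup>2 + (2 * t)\<^sup>2 * (k\<^sup>2 - 1))"
    unfolding v_def q_def[symmetric] mink_scaleR_left mink_scaleR_right
    by (simp add: mink_bilinear m power2_eq_square algebra_simps)
  also have "(1 - (k\<^sup>2 - 1) * t\<^sup>2)\<^sup>2 + (2 * t)\<^sup>2 * (k\<^sup>2 - 1) = q\<^sup>2"
    by (simp add: q_def power2_eq_square algebra_simps)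
  finally have "mink v v = (2 / q\<^sup>2)\<^sup>2 * q\<^sup>2" .
  also have "\<dots> = (2 / q)\<^sup>2" using q by (simp add: power2_eq_square)
  finally show ?thesis by (simp add: q_def)
qed

text \<open>
  A left inverse of the parametrization, chosen as a quotient of affine functions with nonvanishing
  denominator on the arc, so that it is also differentiable at the base point \<open>x\<close>.
\<close>

definition cycle_coord :: "mvec \<Rightarrow> mvec \<Rightarrow> real \<Rightarrow> mvec \<Rightarrow> real" where
  "cycle_coord x e k y = mink y e / (2 + (k\<^sup>2 - 1) * (mink y x + 1))"

lemma cycle_coord_cycle_param:
  assumes fr: "frame x e \<nu>" and t: "\<bar>t\<bar> < 1"
  shows "2 + (k\<^sup>2 - 1) * (mink (cycle_param x e \<nu> k t) x + 1) \<noteq> 0"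
    and "cycle_coord x e k (cycle_param x e \<nu> k t) = t"
proof -
  note m = frame_mink[OF fr]
  define q where "q = 1 + (k\<^sup>2 - 1) * t\<^sup>2"
  define y where "y = cycle_param x e \<nu> k t"
  have q: "q > 0" using denominator_pos[OF t] by (simp add: q_def)
  have yx: "mink y x = -1 - 2 * t\<^sup>2 / q" and ye: "mink y e = 2 * t / q"
    by (simp_all add: y_def cycle_param_def mink_bilinear m q_def)
  have "2 + (k\<^sup>2 - 1) * (mink y x + 1) = (2 * q - 2 * ((k\<^sup>2 - 1) * t\<^sup>2)) / q"
    using q by (simp add: yx field_simps)
  also have "2 * q - 2 * ((k\<^sup>2 - 1) * t\<^sup>2) = 2" by (simp add: q_def)
  finally have d: "2 + (k\<^sup>2 - 1) * (mink y x + 1) = 2 / q" .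
  show "2 + (k\<^sup>2 - 1) * (mink (cycle_param x e \<nu> k t) x + 1) \<noteq> 0"
    using d q by (simp add: y_def)
  show "cycle_coord x e k (cycle_param x e \<nu> k t) = t"
    unfolding cycle_coord_def y_def[symmetric] d ye using q by simp
qed

text \<open>
  Any \<open>C\<^sup>1\<close> arc onto the same point set is a reparametrization
  \<open>\<gamma> = cycle_param \<circ> u\<close>. The coordinate \<open>u\<close> is
  differentiable because it is a smooth function of the point, and monotone because it is
  continuous and injective; so \<open>\<bar>u'\<bar>\<close> is \<open>u'\<close> or
  \<open>-u'\<close> throughout and the integral telescopes. This is what makes the definite
  description in the definition of the length meaningful.
\<close>

lemma integral_speed_cycle_arc:
  assumes fr: "frame x e \<nu>" and \<tau>: "0 < \<tau>" "\<tau> < 1"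
    and \<gamma>: "arc \<gamma>" "\<gamma> C1_differentiable_on {0..1}" "path_image \<gamma> = cycle_param x e \<nu> k ` {0..\<tau>}"
  shows "integral {0..1} (\<lambda>t. sqrt (mink (vector_derivative \<gamma> (at t)) (vector_derivative \<gamma> (at t))))
    = arc_length k \<tau>"
proof -
  let ?g = "\<lambda>t::real. 2 / (1 + (k\<^sup>2 - 1) * t\<^sup>2)"
  define u where "u = (\<lambda>s. cycle_coord x e k (\<gamma> s))"
  have coord: "\<gamma> s = cycle_param x e \<nu> k (u s)" "u s \<in> {0..\<tau>}"
      "2 + (k\<^sup>2 - 1) * (mink (\<gamma> s) x + 1) \<noteq> 0" if "s \<in> {0..1}" for s
  proof -
    have "\<gamma> s \<in> cycle_param x e \<nu> k ` {0..\<tau>}"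
      using \<gamma>(3) that by (auto simp: path_image_def)
    then obtain t where t: "t \<in> {0..\<tau>}" "\<gamma> s = cycle_param x e \<nu> k t" by auto
    then have "\<bar>t\<bar> < 1" using \<tau> by auto
    from cycle_coord_cycle_param[OF fr this, of k] t
    show "\<gamma> s = cycle_param x e \<nu> k (u s)" "u s \<in> {0..\<tau>}"
      "2 + (k\<^sup>2 - 1) * (mink (\<gamma> s) x + 1) \<noteq> 0" by (auto simp: u_def)
  qed
  have small: "\<bar>u s\<bar> < 1" if "s \<in> {0..1}" for s using coord(2)[OF that] \<tau> by auto
  have img: "u ` {0..1} = {0..\<tau>}"
  proof
    show "u ` {0..1} \<subseteq> {0..\<tau>}" using coord(2) by auto
    show "{0..\<tau>} \<subseteq> u ` {0..1}"
    proof
      fix t assume t: "t \<in> {0..\<tau>}"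
      then have "cycle_param x e \<nu> k t \<in> path_image \<gamma>" using \<gamma>(3) by auto
      then obtain s where s: "s \<in> {0..1}" "\<gamma> s = cycle_param x e \<nu> k t"
        by (auto simp: path_image_def)
      have "\<bar>t\<bar> < 1" using t \<tau> by auto
      then have "u s = t" using s(2) cycle_coord_cycle_param(2)[OF fr] by (simp add: u_def)
      then show "t \<in> u ` {0..1}" using s by auto
    qed
  qed
  have inj: "inj_on u {0..1}"
  proof (rule inj_onI)
    fix s t assume st: "s \<in> {0..1}" "t \<in> {0..1}" "u s = u t"
    then have "\<gamma> s = \<gamma> t" using coord(1)[OF st(1)] coord(1)[OF st(2)] by simp
    then show "s = t" using \<gamma>(1) st(1,2) unfolding arc_def by (elim conjE) (rule inj_onD)
  qed
  have dif: "\<exists>d. (u has_real_derivative d) (at s)" if s: "s \<in> {0..1}" for s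
  proof -
    obtain V where "(\<forall>s\<in>{0..1}. (\<gamma> has_vector_derivative V s) (at s)) \<and> continuous_on {0..1} V"
      using \<gamma>(2) unfolding C1_differentiable_on_def ..
    then have d: "(\<gamma> has_vector_derivative V s) (at s)" using s by (elim conjE bspec)
    have "((\<lambda>s. mink (\<gamma> s) z) has_real_derivative mink (V s) z) (at s)" for z
      unfolding has_real_derivative_iff_has_vector_derivative
      by (rule bounded_linear.has_vector_derivative[OF bounded_linear_mink d])
    note D = this
    have "((\<lambda>s. 2 + (k\<^sup>2 - 1) * (mink (\<gamma> s) x + 1)) has_real_derivative
        0 + (k\<^sup>2 - 1) * (mink (V s) x + 0)) (at s)"
      by (intro DERIV_add DERIV_cmult DERIV_const D)
    from DERIV_divide[OF D this coord(3)[OF s]] show ?thesis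
      unfolding u_def cycle_coord_def by (rule exI)
  qed
  define u' where "u' = deriv u"
  have u': "(u has_real_derivative u' s) (at s)" if s: "s \<in> {0..1}" for s
  proof -
    obtain d where "(u has_real_derivative d) (at s)" using dif[OF s] ..
    then show ?thesis unfolding u'_def by (simp only: DERIV_imp_deriv)
  qed
  have contu: "continuous_on {0..1} u"
    by (intro continuous_at_imp_continuous_on ballI DERIV_isCont[OF u'])
  obtain G where "(\<forall>t. \<bar>t\<bar> < 1 \<longrightarrow> (G has_real_derivative ?g t) (at t)) \<and>
      (\<forall>\<tau>. 0 \<le> \<tau> \<and> \<tau> < 1 \<longrightarrow> arc_length k \<tau> = G \<tau> - G 0)"
    using arc_length_antiderivative[of k] ..
  then have G: "\<And>t. \<bar>t\<bar> < 1 \<Longrightarrow> (G has_real_derivative ?g t) (at t)"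
    and len: "arc_length k \<tau> = G \<tau> - G 0"
    using \<tau> by simp_all
  have GU: "((\<lambda>s. G (u s)) has_real_derivative ?g (u s) * u' s) (at s)" if "s \<in> {0..1}" for s
    by (rule DERIV_chain2[OF G[OF small[OF that]] u'[OF that]])
  have int: "((\<lambda>s. ?g (u s) * u' s) has_integral (G (u 1) - G (u 0))) {0..1}"
    using GU[unfolded has_real_derivative_iff_has_vector_derivative, THEN has_vector_derivative_at_within]
    by (intro fundamental_theorem_of_calculus) simp_all
  have speed: "sqrt (mink (vector_derivative \<gamma> (at s)) (vector_derivative \<gamma> (at s))) = ?g (u s) * \<bar>u' s\<bar>"
    if s: "s \<in> {0<..<1}" for s
  proof -
    have s': "s \<in> {0..1}" using s by auto
    let ?v = "(2 / (1 + (k\<^sup>2 - 1) * (u s)\<^sup>2)\<^sup>2) *\<^sub>R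
      ((1 - (k\<^sup>2 - 1) * (u s)\<^sup>2) *\<^sub>R e + (2 * u s) *\<^sub>R (x + k *\<^sub>R \<nu>))"
    have "((cycle_param x e \<nu> k \<circ> u) has_vector_derivative u' s *\<^sub>R ?v) (at s)"
      using u'[OF s'] cycle_param_has_vector_derivative[OF small[OF s']]
      by (intro vector_diff_chain_at) (auto simp: has_real_derivative_iff_has_vector_derivative)
    then have "(\<gamma> has_vector_derivative u' s *\<^sub>R ?v) (at s)"
      by (rule has_vector_derivative_transform_within_open[where S = "{0<..<1}"])
        (use s coord(1) in auto)
    then have vd: "vector_derivative \<gamma> (at s) = u' s *\<^sub>R ?v" by (rule vector_derivative_at)
    have scale: "mink (a *\<^sub>R z) (a *\<^sub>R z) = a\<^sup>2 * mink z z" for a z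
      by (simp add: mink_bilinear power2_eq_square)
    have "mink (vector_derivative \<gamma> (at s)) (vector_derivative \<gamma> (at s)) = (u' s * ?g (u s))\<^sup>2"
      unfolding vd scale[of "u' s" ?v] mink_cycle_param_velocity[OF fr small[OF s']]
      by (rule power_mult_distrib[symmetric])
    moreover have "?g (u s) > 0" using denominator_pos[OF small[OF s']] by (rule divide_pos_pos[OF zero_less_numeral])
    ultimately show ?thesis by (simp only: real_sqrt_abs abs_mult abs_of_pos mult.commute)
  qed
  have main: "((\<lambda>t. sqrt (mink (vector_derivative \<gamma> (at t)) (vector_derivative \<gamma> (at t))))
      has_integral arc_length k \<tau>) {0..1}"
  proof (rule has_integral_spike_finite[where S = "{0,1}" and f = "\<lambda>s. ?g (u s) * \<bar>u' s\<bar>"])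
    obtain a b where a: "a \<in> {0..1}" "u a = 0" and b: "b \<in> {0..1}" "u b = \<tau>"
    proof -
      have "0 \<in> u ` {0..1}" "\<tau> \<in> u ` {0..1}" unfolding img using \<tau> by simp_all
      then show thesis by (elim imageE) (rule that, assumption, erule sym, assumption, erule sym)
    qed
    have range: "0 \<le> u 0" "u 0 \<le> \<tau>" "0 \<le> u 1" "u 1 \<le> \<tau>"
      using coord(2)[of 0] coord(2)[of 1] by simp_all
    have "strict_mono_on {0..1} u \<or> strict_antimono_on {0..1} u"
      using injective_eq_monotone_map[OF is_interval_cc contu] inj by blast
    then show "((\<lambda>s. ?g (u s) * \<bar>u' s\<bar>) has_integral arc_length k \<tau>) {0..1}"
    proof
      assume "strict_mono_on {0..1} u"
      then have mono: "mono_on {0..1} u" by (rule strict_mono_on_imp_mono_on)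
      have sgn: "u' s \<ge> 0" if s: "s \<in> {0<..<1}" for s
        by (rule mono_on_imp_deriv_nonneg[OF mono u']) (use s in simp_all)
      have ends: "u 0 = 0" "u 1 = \<tau>"
        using mono_onD[OF mono, of 0 a] mono_onD[OF mono, of b 1] a b range by simp_all
      have signed: "((\<lambda>s. ?g (u s) * u' s) has_integral arc_length k \<tau>) {0..1}"
        using int unfolding ends len .
      show ?thesis
      proof (rule has_integral_spike_finite[OF _ _ signed])
        show "finite {0, 1 :: real}" by simp
        fix s :: real
        assume "s \<in> {0..1} - {0, 1}"
        then have "s \<in> {0<..<1}" by auto
        from sgn[OF this] show "?g (u s) * \<bar>u' s\<bar> = ?g (u s) * u' s" by (simp only: abs_of_nonneg)
      qed
    next
      assume "strict_antimono_on {0..1} u"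
      then have anti: "u t \<le> u s" if "s \<in> {0..1}" "t \<in> {0..1}" "s \<le> t" for s t
        using that monotone_onD[of "{0..1}" "(<)" "\<lambda>x y. y < x" u s t] by (cases "s = t") simp_all
      have mono: "mono_on {0..1} (\<lambda>s. - u s)"
        by (rule mono_onI) (simp only: neg_le_iff_le anti)
      have sgn: "u' s \<le> 0" if s: "s \<in> {0<..<1}" for s
      proof -
        have "0 \<le> - u' s"
          by (rule mono_on_imp_deriv_nonneg[OF mono DERIV_minus[OF u']]) (use s in simp_all)
        then show ?thesis by simp
      qed
      have ends: "u 1 = 0" "u 0 = \<tau>"
        using anti[of a 1] anti[of 0 b] a b range by simp_all
      have "((\<lambda>s. - (?g (u s) * u' s)) has_integral - (G (u 1) - G (u 0))) {0..1}"
        by (rule has_integral_neg[OF int])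
      then have signed: "((\<lambda>s. - (?g (u s) * u' s)) has_integral arc_length k \<tau>) {0..1}"
        unfolding ends len minus_diff_eq .
      show ?thesis
      proof (rule has_integral_spike_finite[OF _ _ signed])
        show "finite {0, 1 :: real}" by simp
        fix s :: real
        assume "s \<in> {0..1} - {0, 1}"
        then have "s \<in> {0<..<1}" by auto
        from sgn[OF this] show "?g (u s) * \<bar>u' s\<bar> = - (?g (u s) * u' s)"
          by (simp only: abs_of_nonpos mult_minus_right)
      qed
    qed
  next
    show "finite {0, 1 :: real}" by simp
    fix s :: real
    assume "s \<in> {0..1} - {0, 1}"
    then have "s \<in> {0<..<1}" by auto
    then show "sqrt (mink (vector_derivative \<gamma> (at s)) (vector_derivative \<gamma> (at s))) = ?g (u s) * \<bar>u' s\<bar>"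
      by (rule speed)
  qed
  then show ?thesis by (rule integral_unique)
qed

lemma hlength_cycle_arc:
  assumes fr: "frame x e \<nu>" and \<tau>: "0 < \<tau>" "\<tau> < 1"
  shows "hlength (cycle_param x e \<nu> k ` {0..\<tau>}) = arc_length k \<tau>"
proof -
  let ?\<gamma> = "cycle_param x e \<nu> k \<circ> (\<lambda>s. \<tau> * s)"
  let ?v = "\<lambda>t. (2 / (1 + (k\<^sup>2 - 1) * t\<^sup>2)\<^sup>2) *\<^sub>R
      ((1 - (k\<^sup>2 - 1) * t\<^sup>2) *\<^sub>R e + (2 * t) *\<^sub>R (x + k *\<^sub>R \<nu>))"
  have small: "\<bar>\<tau> * s\<bar> < 1" if "s \<in> {0..1}" for s
  proof -
    have "0 \<le> \<tau> * s" "\<tau> * s \<le> \<tau>" using that \<tau> by (auto intro: mult_left_le)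
    then show ?thesis using \<tau> by linarith
  qed
  have der: "(?\<gamma> has_vector_derivative \<tau> *\<^sub>R ?v (\<tau> * s)) (at s)" if "s \<in> {0..1}" for s
    using cycle_param_has_vector_derivative[OF small[OF that]]
    by (intro vector_diff_chain_at) (auto intro!: derivative_eq_intros)
  have "continuous_on {0..1} (\<lambda>s. \<tau> *\<^sub>R ?v (\<tau> * s))"
    using denominator_pos[OF small, of _ k] by (auto intro!: continuous_intros simp: less_imp_neq[symmetric])
  then have C1: "?\<gamma> C1_differentiable_on {0..1}"
    unfolding C1_differentiable_on_def
    by (intro exI[of _ "\<lambda>s. \<tau> *\<^sub>R ?v (\<tau> * s)"] conjI ballI der)
  have "continuous_on {0..1} ?\<gamma>"
    using der by (meson has_vector_derivative_continuous continuous_at_imp_continuous_on)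
  moreover have "inj_on ?\<gamma> {0..1}"
  proof (rule inj_onI)
    fix s t assume "s \<in> {0..1}" "t \<in> {0..1}" "?\<gamma> s = ?\<gamma> t"
    then have "\<tau> * s = \<tau> * t"
      using cycle_coord_cycle_param(2)[OF fr small, of _ k] unfolding comp_apply
      using \<open>s \<in> {0..1}\<close> \<open>t \<in> {0..1}\<close> by metis
    then show "s = t" using \<tau> by simp
  qed
  ultimately have arc: "arc ?\<gamma>" by (auto simp: arc_def path_def)
  have "(\<lambda>s. \<tau> * s) ` {0..1} = {0..\<tau>}" using \<tau> by (simp add: image_mult_atLeastAtMost_if)
  then have img: "path_image ?\<gamma> = cycle_param x e \<nu> k ` {0..\<tau>}"
    unfolding path_image_def image_comp[symmetric] by simp
  show ?thesis unfolding hlength_def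
  proof (rule the_equality)
    show "\<exists>\<gamma>. arc \<gamma> \<and> \<gamma> C1_differentiable_on {0..1} \<and> path_image \<gamma> = cycle_param x e \<nu> k ` {0..\<tau>} \<and>
        arc_length k \<tau> = integral {0..1} (\<lambda>t. sqrt (mink (vector_derivative \<gamma> (at t)) (vector_derivative \<gamma> (at t))))"
      by (intro exI[of _ ?\<gamma>] conjI arc C1 img integral_speed_cycle_arc[OF fr \<tau> arc C1 img, symmetric])
  qed (elim exE conjE, simp only: integral_speed_cycle_arc[OF fr \<tau>])
qed

text \<open>
  A point of the cycle lies in the closed disk of \<open>D\<close> exactly when its slope
  \<open>t\<close>, seen from the common point \<open>x\<close>, is between \<open>0\<close> and
  \<open>\<tau>\<close>. Here \<open>\<tau>\<close> is the hyperbolic tangent of the radius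
  of \<open>D\<close>.
\<close>

lemma cycle_arc_in_perpendicular_circle:
  assumes fr: "frame x e \<nu>" and C: "gcircle_ok C" and D: "gcircle_ok D"
    and w: "cycle_vector C = x + (1 / geod_curv C) *\<^sub>R \<nu>"
    and wD: "cycle_vector D = x + \<tau> *\<^sub>R e" and \<tau>: "0 < \<tau>" "\<tau> < 1"
  shows "gpoints C \<inter> (ginside D \<union> gpoints D) = cycle_param x e \<nu> (geod_curv C) ` {0..\<tau>}"
proof (intro subset_antisym subsetI)
  define k where "k = geod_curv C"
  have k: "k > 0" using geod_curv_pos[OF C] by (simp add: k_def)
  note m = frame_mink[OF fr]
  fix y
  {
    assume "y \<in> cycle_param x e \<nu> (geod_curv C) ` {0..\<tau>}"
    then obtain t where t: "0 \<le> t" "t \<le> \<tau>" and y: "y = cycle_param x e \<nu> k t"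
      by (auto simp: k_def)
    have t1: "\<bar>t\<bar> < 1" using t \<tau> by auto
    have yC: "y \<in> gpoints C" using cycle_param_mem[OF fr C w t1] y by (simp add: k_def)
    define q where "q = 1 + (k\<^sup>2 - 1) * t\<^sup>2"
    have q: "q > 0" using denominator_pos[OF t1] by (simp add: q_def)
    have "mink y (cycle_vector D) = -1 + (1 / q) * (2 * t * \<tau> - 2 * t\<^sup>2)"
      unfolding y wD cycle_param_def q_def[symmetric] by (simp add: mink_bilinear m algebra_simps)
    moreover have "2 * t * \<tau> - 2 * t\<^sup>2 \<ge> 0" using t by (simp add: power2_eq_square mult_left_mono)
    ultimately have "mink y (cycle_vector D) \<ge> -1" using q by simp
    then show "y \<in> gpoints C \<inter> (ginside D \<union> gpoints D)"
      using yC by (auto simp: gpoints_eq[OF C] gpoints_eq[OF D] ginside_eq[OF D])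
  next
    assume "y \<in> gpoints C \<inter> (ginside D \<union> gpoints D)"
    then have y: "y \<in> hplane" "mink y (cycle_vector C) = -1" "mink y (cycle_vector D) \<ge> -1"
      by (auto simp: gpoints_eq[OF C] gpoints_eq[OF D] ginside_eq[OF D])
    define \<alpha> \<beta> where "\<alpha> = mink y e" and "\<beta> = - mink y x - 1"
    have "mink y \<nu> = k * \<beta>"
      using y(2) k unfolding w by (simp add: mink_bilinear \<beta>_def k_def[symmetric] field_simps)
    then have ye: "y = (1 + \<beta>) *\<^sub>R x + \<alpha> *\<^sub>R e + (k * \<beta>) *\<^sub>R \<nu>"
      using frame_expansion[OF fr, of y] by (simp add: \<alpha>_def \<beta>_def)
    have \<beta>: "\<beta> \<ge> 0" using hplane_mink_le[OF y(1) m(10)] by (simp add: \<beta>_def)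
    have le: "\<beta> \<le> \<tau> * \<alpha>" using y(3) unfolding wD by (simp add: mink_bilinear \<alpha>_def \<beta>_def)
    have "mink y y = - (1 + \<beta>)\<^sup>2 + \<alpha>\<^sup>2 + k\<^sup>2 * \<beta>\<^sup>2"
      unfolding ye by (simp add: mink_bilinear m power2_eq_square algebra_simps)
    then have eq: "\<alpha>\<^sup>2 + (k\<^sup>2 - 1) * \<beta>\<^sup>2 = 2 * \<beta>"
      using hplane_self[OF y(1)] by (simp add: power2_eq_square algebra_simps)
    have \<alpha>: "\<alpha> \<ge> 0" using \<beta> le \<tau> by (metis mult_pos_neg not_le order.trans)
    show "y \<in> cycle_param x e \<nu> (geod_curv C) ` {0..\<tau>}"
    proof (cases "\<alpha> = 0")
      case True
      then have "\<beta> = 0" using le \<beta> by simp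
      then have "y = cycle_param x e \<nu> k 0" using ye True by simp
      then show ?thesis using \<tau> unfolding k_def by (intro image_eqI[of _ _ 0]) auto
    next
      case False
      define t where "t = \<beta> / \<alpha>"
      have t: "0 \<le> t" "t \<le> \<tau>" using \<alpha> False \<beta> le by (auto simp: t_def field_simps)
      have bt: "\<beta> = t * \<alpha>" using False by (simp add: t_def)
      have t1: "\<bar>t\<bar> < 1" using t \<tau> by auto
      define q where "q = 1 + (k\<^sup>2 - 1) * t\<^sup>2"
      have q: "q > 0" using denominator_pos[OF t1] by (simp add: q_def)
      have "\<alpha> * (\<alpha> * q) = \<alpha> * (2 * t)"
        using eq by (simp add: bt q_def power2_eq_square algebra_simps)
      then have "\<alpha> = 2 * t / q" using False q by (simp add: field_simps)
      moreover have "\<beta> = 2 * t\<^sup>2 / q" using calculation bt by (simp add: power2_eq_square)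
      ultimately have "y = cycle_param x e \<nu> k t"
        unfolding ye cycle_param_def q_def[symmetric] by (simp add: algebra_simps)
      then show ?thesis using t by (auto simp: k_def)
    qed
  }
qed

lemma total_curv_in_perpendicular:
  assumes C: "gcircle_ok C" and D: "gcircle_ok (Circle p r)" and perp: "perpendicular (Circle p r) C"
  shows "total_curv_in (Circle p r) C = geod_curv C * arc_length (geod_curv C) (tanh r)"
proof -
  obtain x e \<nu> where fr: "frame x e \<nu>" and w: "cycle_vector C = x + (1 / geod_curv C) *\<^sub>R \<nu>"
    and wD: "cycle_vector (Circle p r) = x + (1 / geod_curv (Circle p r)) *\<^sub>R e"
    using perpendicular_frame[OF assms] by blast
  have wD: "cycle_vector (Circle p r) = x + tanh r *\<^sub>R e" using wD by simp
  have \<tau>: "0 < tanh r" "tanh r < 1" using D tanh_real_lt_1 by auto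
  show ?thesis
    unfolding total_curv_in_def cycle_arc_in_perpendicular_circle[OF fr C D w wD \<tau>]
      hlength_cycle_arc[OF fr \<tau>] ..
qed

section \<open>The total geodesic curvature inside a triangle\<close>

text \<open>
  Four vectors in three-space satisfy one relation between their products. It is found by expanding
  the vectors of \<open>C3\<close> and \<open>D\<close> in the frame at the point of
  tangency of \<open>C1\<close> and \<open>C2\<close>: tangency and perpendicularity determine
  all coordinates, and the square of the vector of \<open>C3\<close> is the remaining equation.
\<close>

lemma dual_circle_curvature:
  assumes C: "gcircle_ok C1" "gcircle_ok C2" "gcircle_ok C3" and D: "gcircle_ok D"
    and tan: "externally_tangent C1 C2" "externally_tangent C1 C3" "externally_tangent C2 C3"
    and perp: "perpendicular D C1" "perpendicular D C2" "perpendicular D C3"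
  shows "(geod_curv D)\<^sup>2 = 1 + geod_curv C1 * geod_curv C2 + geod_curv C2 * geod_curv C3
    + geod_curv C3 * geod_curv C1"
proof -
  define a b c \<tau> where "a = 1 / geod_curv C1" and "b = 1 / geod_curv C2"
    and "c = 1 / geod_curv C3" and "\<tau> = 1 / geod_curv D"
  have pos: "a > 0" "b > 0" "c > 0" "\<tau> > 0"
    using geod_curv_pos C D by (auto simp: a_def b_def c_def \<tau>_def)
  have k: "geod_curv C1 = 1 / a" "geod_curv C2 = 1 / b" "geod_curv C3 = 1 / c" "geod_curv D = 1 / \<tau>"
    by (auto simp: a_def b_def c_def \<tau>_def)
  obtain x e \<nu> where fr: "frame x e \<nu>" and w1: "cycle_vector C1 = x + a *\<^sub>R \<nu>"
    and w2: "cycle_vector C2 = x - b *\<^sub>R \<nu>"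
    using externally_tangent_frame[OF C(1,2) tan(1)] unfolding a_def b_def by blast
  note m = frame_mink[OF fr]
  define u where "u = cycle_vector D"
  define w where "w = cycle_vector C3"
  have "mink u (x + a *\<^sub>R \<nu>) = -1" "mink u (x - b *\<^sub>R \<nu>) = -1"
    using mink_perpendicular[OF C(1) D perp(1)] mink_perpendicular[OF C(2) D perp(2)]
    unfolding w1 w2 u_def by blast+
  then have ux: "mink u x + a * mink u \<nu> = -1" "mink u x - b * mink u \<nu> = -1"
    by (simp_all add: mink_bilinear)
  then have "(a + b) * mink u \<nu> = 0" unfolding distrib_right by linarith
  then have un: "mink u \<nu> = 0" using pos by simp
  then have ux: "mink u x = -1" using ux(1) by simp
  define y' where "y' = mink u e"
  have u: "u = x + y' *\<^sub>R e"
  proof -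
    have "u = (- mink u x) *\<^sub>R x + mink u e *\<^sub>R e + mink u \<nu> *\<^sub>R \<nu>" by (rule frame_expansion[OF fr])
    also have "\<dots> = x + y' *\<^sub>R e" by (simp only: ux un y'_def) simp
    finally show ?thesis .
  qed
  have "mink u u = \<tau>\<^sup>2 - 1" using mink_cycle_vector_self[OF D] by (simp add: u_def \<tau>_def)
  then have y': "y'\<^sup>2 = \<tau>\<^sup>2" unfolding u by (simp add: mink_bilinear m power2_eq_square)
  define X Y Z where "X = - mink w x" and "Y = mink w e" and "Z = mink w \<nu>"
  have w: "w = X *\<^sub>R x + Y *\<^sub>R e + Z *\<^sub>R \<nu>"
    unfolding X_def Y_def Z_def by (rule frame_expansion[OF fr])
  have "mink (x + a *\<^sub>R \<nu>) w = - 1 - a * c" "mink (x - b *\<^sub>R \<nu>) w = - 1 - b * c"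
    using mink_externally_tangent[OF C(1,3) tan(2)] mink_externally_tangent[OF C(2,3) tan(3)]
    unfolding w1 w2 w_def[symmetric] k by simp_all
  then have e1: "- X + a * Z = - 1 - a * c" and e2: "- X - b * Z = - 1 - b * c"
    unfolding w by (simp_all add: mink_bilinear m mult.commute)
  have "mink u w = -1"
    using mink_perpendicular[OF C(3) D perp(3)] by (simp add: u_def w_def)
  then have "- X + y' * Y = - 1" unfolding u w by (simp add: mink_bilinear m mult.commute)
  then have e3: "y' * Y = X - 1" by linarith
  have "mink w w = c\<^sup>2 - 1" using mink_cycle_vector_self[OF C(3)] by (simp add: w_def c_def)
  then have e4: "Y\<^sup>2 = X\<^sup>2 - 1 + c\<^sup>2 - Z\<^sup>2"
    unfolding w by (simp add: mink_bilinear m power2_eq_square)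
  \<comment> \<open>The quantity \<open>M\<close> turns all coordinates into polynomials.\<close>
  define M where "M = c / (a + b)"
  have c: "c = M * (a + b)" and M: "M > 0" using pos by (auto simp: M_def)
  have "(a + b) * Z = (a + b) * (M * (b - a))" 
  proof -
    have "a * Z + b * Z = b * c - a * c" using e1 e2 by linarith
    then show ?thesis unfolding c by (simp add: algebra_simps)
  qed
  then have Z: "Z = M * (b - a)" using pos by (metis add_pos_pos less_irrefl mult_cancel_left)
  have "X = 1 + a * c + a * Z" using e1 by linarith
  then have X: "X = 1 + 2 * a * b * M" unfolding Z c by (simp add: algebra_simps)
  have "(y' * Y)\<^sup>2 = \<tau>\<^sup>2 * Y\<^sup>2" by (simp add: power_mult_distrib y')
  then have "(2 * a * b * M)\<^sup>2 = \<tau>\<^sup>2 * ((1 + 2 * a * b * M)\<^sup>2 - 1 + c\<^sup>2 - Z\<^sup>2)"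
    unfolding e3 e4 X by simp
  also have "(1 + 2 * a * b * M)\<^sup>2 - 1 + c\<^sup>2 - Z\<^sup>2 = 4 * a * b * M * (1 + a * b * M + M)"
    unfolding c Z by (simp add: power2_eq_square algebra_simps)
  finally have "(4 * a * b * M) * (a * b * M) = (4 * a * b * M) * (\<tau>\<^sup>2 * (1 + a * b * M + M))"
    by (simp add: power2_eq_square algebra_simps)
  then have "a * b * M = \<tau>\<^sup>2 * (1 + a * b * M + M)" using pos M by simp
  then have "(1 / \<tau>)\<^sup>2 = (1 + a * b * M + M) / (a * b * M)"
    using pos M by (simp add: power_divide frac_eq_eq mult.commute)
  also have "\<dots> = 1 + 1 / (a * b) + 1 / (a * b * M)"
    using pos M by (simp add: field_simps)
  also have "1 / (a * b * M) = (1 / b) * (1 / c) + (1 / c) * (1 / a)"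
  proof -
    have "1 / (a * b * M) = (a + b) / (a * b * c)" using pos M by (simp add: c)
    also have "\<dots> = (1 / b) * (1 / c) + (1 / c) * (1 / a)" using pos by (simp add: field_simps)
    finally show ?thesis .
  qed
  finally show ?thesis by (simp add: k)
qed

text \<open>
  The upper limit is \<open>tanh R\<close> for the radius \<open>R\<close> of the dual circle, whose
  curvature is \<open>coth R\<close>.
\<close>

definition face_total_curv :: "real \<Rightarrow> real \<Rightarrow> real \<Rightarrow> real" where
  "face_total_curv k\<^sub>1 k\<^sub>2 k\<^sub>3 = k\<^sub>1 * arc_length k\<^sub>1 (1 / sqrt (1 + k\<^sub>1 * k\<^sub>2 + k\<^sub>2 * k\<^sub>3 + k\<^sub>3 * k\<^sub>1))"

lemma total_curv_in_triangle_packing: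
  assumes P: "triangle_packing {u, v, w} C D" and ne: "u \<noteq> v" "u \<noteq> w" "v \<noteq> w"
  shows "total_curv_in D (C u) = face_total_curv (geod_curv (C u)) (geod_curv (C v)) (geod_curv (C w))"
proof -
  have "\<exists>p r. D = Circle p r" using P by (simp only: triangle_packing_def)
  then obtain p r where D: "D = Circle p r" by (elim exE)
  have ok: "gcircle_ok (C u)" "gcircle_ok (C v)" "gcircle_ok (C w)" "gcircle_ok D"
    and perp: "perpendicular D (C u)" "perpendicular D (C v)" "perpendicular D (C w)"
    and tan: "externally_tangent (C u) (C v)" "externally_tangent (C u) (C w)"
      "externally_tangent (C v) (C w)"
    using P ne by (simp_all add: triangle_packing_def)
  have r: "tanh r > 0" using ok(4) D by simp
  let ?s = "1 + geod_curv (C u) * geod_curv (C v) + geod_curv (C v) * geod_curv (C w)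
    + geod_curv (C w) * geod_curv (C u)"
  have "(1 / tanh r)\<^sup>2 = ?s"
    using dual_circle_curvature[OF ok tan perp] by (simp add: D)
  then have "1 / tanh r = sqrt ?s" 
    using r real_sqrt_unique[of "1 / tanh r" ?s] by simp
  then have "1 / (1 / tanh r) = 1 / sqrt ?s" by (rule arg_cong)
  then have "tanh r = 1 / sqrt ?s" by (simp only: divide_divide_eq_right div_by_1 mult_1_left)
  then show ?thesis
    using total_curv_in_perpendicular[OF ok(1) ok(4)[unfolded D] perp(1)[unfolded D]]
    by (simp add: D face_total_curv_def)
qed

section \<open>Monotonicity of the total geodesic curvature\<close>

text \<open>
  The substitution \<open>t = w / sqrt (1 + w\<^sup>2)\<close> passes from the hyperbolic tangent of
  the radius of the dual circle to its hyperbolic sine. In the new variable the curvature occurs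
  only in the product \<open>k * w\<close>, which makes the effect of scaling all curvatures
  visible.
\<close>

lemma arc_length_antiderivative_sinh:
  "\<exists>H. (\<forall>w. (H has_real_derivative 2 / (sqrt (1 + w\<^sup>2) * (1 + k\<^sup>2 * w\<^sup>2))) (at w)) \<and>
    (\<forall>w\<ge>0. arc_length k (w / sqrt (1 + w\<^sup>2)) = H w - H 0)"
proof -
  obtain G where G: "\<And>t. \<bar>t\<bar> < 1 \<Longrightarrow> (G has_real_derivative 2 / (1 + (k\<^sup>2 - 1) * t\<^sup>2)) (at t)"
    and len: "\<And>\<tau>. 0 \<le> \<tau> \<Longrightarrow> \<tau> < 1 \<Longrightarrow> arc_length k \<tau> = G \<tau> - G 0"
    using arc_length_antiderivative[of k] by blast
  let ?t = "\<lambda>w::real. w / sqrt (1 + w\<^sup>2)"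
  have small: "\<bar>?t w\<bar> < 1" for w
  proof -
    have "\<bar>w\<bar> < sqrt (1 + w\<^sup>2)" by (rule real_less_rsqrt) simp
    moreover have "sqrt (1 + w\<^sup>2) > 0" by (simp add: add_pos_nonneg)
    ultimately show ?thesis by (simp add: abs_divide divide_less_eq_1_pos)
  qed
  have "((\<lambda>w. G (?t w)) has_real_derivative 2 / (sqrt (1 + w\<^sup>2) * (1 + k\<^sup>2 * w\<^sup>2))) (at w)" for w
  proof -
    define R where "R = sqrt (1 + w\<^sup>2)"
    have R: "R > 0" "R\<^sup>2 = 1 + w\<^sup>2" by (auto simp: R_def add_pos_nonneg)
    have K: "1 + k\<^sup>2 * w\<^sup>2 > 0" by (simp add: add_pos_nonneg)
    have "1 + w\<^sup>2 > 0" by (simp add: add_pos_nonneg)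
    then have "(?t has_real_derivative (R - w * (w / R)) / R\<^sup>2) (at w)"
      unfolding R_def by (auto intro!: derivative_eq_intros simp: power2_eq_square divide_simps)
    also have "(R - w * (w / R)) / R\<^sup>2 = 1 / R ^ 3"
      using R by (simp add: field_simps power2_eq_square power3_eq_cube)
    finally have "((\<lambda>w. G (?t w)) has_real_derivative 2 / (1 + (k\<^sup>2 - 1) * (?t w)\<^sup>2) * (1 / R ^ 3)) (at w)"
      by (rule DERIV_chain2[where f = G and g = ?t, OF G[OF small]])
    also have "1 + (k\<^sup>2 - 1) * (?t w)\<^sup>2 = (R\<^sup>2 + (k\<^sup>2 - 1) * w\<^sup>2) / R\<^sup>2"
      unfolding R_def[symmetric] using R(1) by (simp add: power_divide add_divide_distrib)
    also have "R\<^sup>2 + (k\<^sup>2 - 1) * w\<^sup>2 = 1 + k\<^sup>2 * w\<^sup>2"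
      using R(2) by (simp add: algebra_simps)
    also have "2 / ((1 + k\<^sup>2 * w\<^sup>2) / R\<^sup>2) * (1 / R ^ 3) = 2 / (R * (1 + k\<^sup>2 * w\<^sup>2))"
      using R(1) K by (simp add: field_simps power2_eq_square power3_eq_cube)
    finally show ?thesis by (simp add: R_def)
  qed
  moreover have "arc_length k (?t w) = G (?t w) - G (?t 0)" if "w \<ge> 0" for w
    using len[of "?t w"] small[of w] that by simp
  ultimately show ?thesis by (intro exI[of _ "\<lambda>w. G (?t w)"]) auto
qed

text \<open>
  After the scaling \<open>w = y / l\<close> the factor \<open>1 + k\<^sup>2 * y\<^sup>2\<close> of the
  integrand is the same on both sides, and what changes is that \<open>sqrt (1 + y\<^sup>2)\<close>
  becomes the smaller \<open>sqrt (1 + (y / l)\<^sup>2)\<close>. The inequality for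
  \<open>w'\<close> beyond \<open>w / l\<close> follows since the integrand is positive.
\<close>

lemma arc_length_scaling:
  fixes k l w w' :: real
  assumes k: "k > 0" and l: "l > 1" and w: "w > 0" and w': "w / l \<le> w'"
  shows "k * arc_length k (w / sqrt (1 + w\<^sup>2)) < l * k * arc_length (l * k) (w' / sqrt (1 + w'\<^sup>2))"
proof -
  obtain H where H: "\<And>w. (H has_real_derivative 2 / (sqrt (1 + w\<^sup>2) * (1 + k\<^sup>2 * w\<^sup>2))) (at w)"
    and lenH: "\<And>w. w \<ge> 0 \<Longrightarrow> arc_length k (w / sqrt (1 + w\<^sup>2)) = H w - H 0"
    using arc_length_antiderivative_sinh[of k] by blast
  obtain H' where H': "\<And>w. (H' has_real_derivative 2 / (sqrt (1 + w\<^sup>2) * (1 + (l * k)\<^sup>2 * w\<^sup>2))) (at w)"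
    and lenH': "\<And>w. w \<ge> 0 \<Longrightarrow> arc_length (l * k) (w / sqrt (1 + w\<^sup>2)) = H' w - H' 0"
    using arc_length_antiderivative_sinh[of "l * k"] by blast
  \<comment> \<open>The two sides as functions of the upper limit; their difference increases from its value at \<open>0\<close>.\<close>
  define h where "h = (\<lambda>y. l * k * H' (y / l) - k * H y)"
  have dh: "(h has_real_derivative
      2 * k / (1 + k\<^sup>2 * y\<^sup>2) * (1 / sqrt (1 + (y / l)\<^sup>2) - 1 / sqrt (1 + y\<^sup>2))) (at y)" for y
  proof -
    have d: "((\<lambda>y. y / l) has_real_derivative 1 / l) (at y)"
      using l by (auto intro!: derivative_eq_intros)
    have "(h has_real_derivative l * k * (2 / (sqrt (1 + (y / l)\<^sup>2) * (1 + (l * k)\<^sup>2 * (y / l)\<^sup>2)) * (1 / l))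
      - k * (2 / (sqrt (1 + y\<^sup>2) * (1 + k\<^sup>2 * y\<^sup>2)))) (at y)"
      unfolding h_def by (intro DERIV_diff DERIV_cmult DERIV_chain2[OF H' d] H)
    also have "(l * k)\<^sup>2 * (y / l)\<^sup>2 = k\<^sup>2 * y\<^sup>2" using l by (simp add: power_mult_distrib power_divide)
    finally show ?thesis using l by (simp add: right_diff_distrib mult.commute)
  qed
  have "h 0 < h w"
  proof (rule DERIV_pos_imp_increasing_open[OF w])
    fix y assume y: "0 < y" "y < w"
    have "y / l < y" using y l by (simp add: divide_less_eq)
    then have "(y / l)\<^sup>2 < y\<^sup>2" using y l by (intro power_strict_mono) auto
    then have "sqrt (1 + (y / l)\<^sup>2) < sqrt (1 + y\<^sup>2)" by simp
    moreover have "sqrt (1 + (y / l)\<^sup>2) > 0" by (simp add: add_pos_nonneg)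
    ultimately have "1 / sqrt (1 + (y / l)\<^sup>2) - 1 / sqrt (1 + y\<^sup>2) > 0"
      by (simp add: frac_less2)
    moreover have "2 * k / (1 + k\<^sup>2 * y\<^sup>2) > 0" using k by (simp add: add_pos_nonneg)
    ultimately show "\<exists>d. (h has_real_derivative d) (at y) \<and> d > 0"
      by (intro exI conjI) (rule dh, rule mult_pos_pos)
  qed (intro continuous_at_imp_continuous_on ballI DERIV_isCont[OF dh])
  then have "k * (H w - H 0) < l * k * (H' (w / l) - H' 0)"
    by (simp add: h_def algebra_simps)
  also have "H' (w / l) \<le> H' w'"
  proof (rule DERIV_nonneg_imp_nondecreasing[OF w'])
    fix y show "\<exists>d. (H' has_real_derivative d) (at y) \<and> d \<ge> 0"
      using H'[of y] by (intro exI conjI) (auto simp: add_nonneg_nonneg)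
  qed
  then have "l * k * (H' (w / l) - H' 0) \<le> l * k * (H' w' - H' 0)"
    using k l by (intro mult_left_mono) auto
  finally have "k * (H w - H 0) < l * k * (H' w' - H' 0)" .
  moreover have "w' \<ge> 0" 
  proof -
    have "0 \<le> w / l" using w l by simp
    then show ?thesis using w' by linarith
  qed
  ultimately show ?thesis using w by (simp add: lenH lenH')
qed

text \<open>
  The hyperbolic sine of the dual radius is the inverse square root of
  \<open>k\<^sub>1 * k\<^sub>2 + k\<^sub>2 * k\<^sub>3 + k\<^sub>3 * k\<^sub>1\<close>. This sum
  grows at most by the factor \<open>l\<^sup>2\<close>, so the dual radius shrinks no more than
  under a uniform scaling by \<open>l\<close>.
\<close>

lemma face_total_curv_less:
  fixes k\<^sub>1 k\<^sub>2 k\<^sub>3 l k\<^sub>2' k\<^sub>3' :: real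
  assumes k: "k\<^sub>1 > 0" "k\<^sub>2 > 0" "k\<^sub>3 > 0" and k': "k\<^sub>2' > 0" "k\<^sub>3' > 0"
    and l: "l > 1" and le: "k\<^sub>2' \<le> l * k\<^sub>2" "k\<^sub>3' \<le> l * k\<^sub>3"
  shows "face_total_curv k\<^sub>1 k\<^sub>2 k\<^sub>3 < face_total_curv (l * k\<^sub>1) k\<^sub>2' k\<^sub>3'"
proof -
  have half: "1 / sqrt (1 + s) = (1 / sqrt s) / sqrt (1 + (1 / sqrt s)\<^sup>2)" if "s > 0" for s :: real
  proof -
    have "1 + (1 / sqrt s)\<^sup>2 = (1 + s) / s" using that by (simp add: power_divide field_simps)
    then show ?thesis using that by (simp add: real_sqrt_divide)
  qed
  define s s' where "s = k\<^sub>1 * k\<^sub>2 + k\<^sub>2 * k\<^sub>3 + k\<^sub>3 * k\<^sub>1"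
    and "s' = (l * k\<^sub>1) * k\<^sub>2' + k\<^sub>2' * k\<^sub>3' + k\<^sub>3' * (l * k\<^sub>1)"
  have pos: "s > 0" "s' > 0" using k k' l by (auto simp: s_def s'_def intro!: add_pos_pos mult_pos_pos)
  have "s' \<le> (l * k\<^sub>1) * (l * k\<^sub>2) + (l * k\<^sub>2) * (l * k\<^sub>3) + (l * k\<^sub>3) * (l * k\<^sub>1)"
    unfolding s'_def using k k' l le by (intro add_mono mult_mono) auto
  also have "\<dots> = l\<^sup>2 * s" by (simp add: s_def power2_eq_square algebra_simps)
  finally have "sqrt s' \<le> l * sqrt s" 
    using l real_sqrt_le_mono[of s' "l\<^sup>2 * s"] by (simp add: real_sqrt_mult)
  then have w: "(1 / sqrt s) / l \<le> 1 / sqrt s'"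
    using pos l by (simp add: field_simps)
  have "k\<^sub>1 * arc_length k\<^sub>1 (1 / sqrt (1 + s)) < l * k\<^sub>1 * arc_length (l * k\<^sub>1) (1 / sqrt (1 + s'))"
    unfolding half[OF pos(1)] half[OF pos(2)]
    by (rule arc_length_scaling[OF k(1) l _ w]) (use pos in simp)
  then show ?thesis by (simp add: face_total_curv_def s_def s'_def add.assoc)
qed

section \<open>Packings on the surface\<close>

lemma triangulation_card_face:
  assumes "triangulation X S V E F" "f \<in> F"
  shows "card (V \<inter> f) = 3"
proof -
  obtain h where h: "embedding_map (top_of_set (convex hull model_corners)) X h"
    "h ` model_corners = V \<inter> f"
    using assms unfolding triangulation_def by metis
  have "inj_on h (convex hull model_corners)"
    using h(1) by (auto simp: embedding_map_def dest!: homeomorphic_imp_injective_map)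
  then have "inj_on h model_corners" by (rule inj_on_subset) (rule hull_subset)
  then have "card (V \<inter> f) = card model_corners" using h(2) card_image by metis
  then show ?thesis by (simp add: model_corners_def)
qed

lemma triangulation_finite_vertices:
  assumes "triangulation X S V E F"
  shows "finite V"
proof -
  have "V = (\<Union>f\<in>F. V \<inter> f)" "finite F" using assms by (auto simp: triangulation_def)
  moreover have "finite (V \<inter> f)" if "f \<in> F" for f
    using triangulation_card_face[OF assms that] by (metis card.infinite zero_neq_numeral)
  ultimately show ?thesis by (metis finite_UN)
qed

text \<open>
  The scaled comparison of \<open>face_total_curv_less\<close> applies in every face at
  \<open>v\<close>; there is such a face because the faces cover the surface.
\<close>

lemma total_curv_less:
  assumes tri: "triangulation X S V E F"
    and P: "circle_packing V F P" and P': "circle_packing V F P'"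
    and v: "v \<in> V" and l: "curv P' v = l * curv P v" "l > 1"
    and le: "\<And>w. w \<in> V \<Longrightarrow> curv P' w \<le> l * curv P w"
  shows "total_curv F P v < total_curv F P' v"
proof -
  have "finite F" "\<Union>F = S" "V \<subseteq> S" using tri by (auto simp: triangulation_def)
  then have "finite {f \<in> F. v \<in> f}" "{f \<in> F. v \<in> f} \<noteq> {}" using v by auto
  then show ?thesis unfolding total_curv_def
  proof (rule sum_strict_mono)
    fix f assume "f \<in> {f \<in> F. v \<in> f}"
    then have f: "f \<in> F" "v \<in> V \<inter> f" using v by auto
    have "card (V \<inter> f - {v}) = 2"
      using triangulation_card_face[OF tri f(1)] f(2) by simp
    then obtain a b where ab: "V \<inter> f - {v} = {a, b}" "a \<noteq> b" by (auto simp: card_2_iff)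
    then have W: "V \<inter> f = {v, a, b}" and ne: "v \<noteq> a" "v \<noteq> b" using f(2) by auto
    have V: "a \<in> V" "b \<in> V" using W by auto
    have pos: "curv P w > 0" "curv P' w > 0" if "w \<in> V" for w
      using P P' that by (auto simp: circle_packing_def)
    have T: "total_curv_in (dual Q f) (circ Q f v) = face_total_curv (curv Q v) (curv Q a) (curv Q b)"
      if "circle_packing V F Q" for Q
    proof -
      have "triangle_packing {v, a, b} (circ Q f) (dual Q f)"
        and "\<forall>w\<in>{v, a, b}. geod_curv (circ Q f w) = curv Q w"
        using that f(1) W unfolding circle_packing_def by metis+
      then show ?thesis using total_curv_in_triangle_packing[OF _ ne ab(2)] by simp
    qed
    show "total_curv_in (dual P f) (circ P f v) < total_curv_in (dual P' f) (circ P' f v)"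
      unfolding T[OF P] T[OF P'] l(1)
      by (rule face_total_curv_less) (use pos v V l(2) le in auto)
  qed
qed

theorem theorem1p5:
  fixes X :: "'a topology" and S V :: "'a set" and E F :: "'a set set"
    and g n :: nat and k k' T :: "'a \<Rightarrow> real" and P P' :: "'a packing"
  assumes "n \<ge> 1" and "surface_gn g n X S" and "triangulation X S V E F"
    and "card (bdry_vertices X S V) \<ge> 2"
    and "\<forall>f\<in>F. card (bdry_vertices X S V \<inter> f) \<le> 2"
    and "\<forall>v\<in>bdry_vertices X S V. k v > 0" and "\<forall>v\<in>bdry_vertices X S V. k' v > 0"
    and "T \<in> admissible_total_curvs (int_vertices X S V) F"
    and "realizes X S V F P k T" and "realizes X S V F P' k' T"
  shows "(Max ((\<lambda>v. curv P' v / curv P v) ` V) > 1 \<longrightarrow>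
            (\<forall>v\<in>int_vertices X S V.
               curv P' v / curv P v \<noteq> Max ((\<lambda>v. curv P' v / curv P v) ` V))) \<and>
         ((\<forall>v\<in>bdry_vertices X S V. curv P' v \<le> curv P v) \<longrightarrow>
            (\<forall>v\<in>V. curv P' v \<le> curv P v))"
proof -
  let ?r = "\<lambda>v. curv P' v / curv P v"
  let ?M = "Max (?r ` V)"
  have P: "circle_packing V F P" "circle_packing V F P'"
    using assms(9,10) by (simp_all add: realizes_def)
  have pos: "curv P v > 0" if "v \<in> V" for v using P(1) that by (simp add: circle_packing_def)
  have fin: "finite (?r ` V)" using triangulation_finite_vertices[OF assms(3)] by simp
  have max: "?r v \<le> ?M" if "v \<in> V" for v using fin that by simp
  have not_int: "?r v \<noteq> ?M" if M: "?M > 1" and v: "v \<in> int_vertices X S V" for v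
  proof
    assume eq: "?r v = ?M"
    have vV: "v \<in> V" using v by (simp add: int_vertices_def)
    have "curv P' v = ?M * curv P v" using pos[OF vV] by (simp flip: eq)
    moreover have "curv P' w \<le> ?M * curv P w" if "w \<in> V" for w
      using max[OF that] pos[OF that] by (simp only: pos_divide_le_eq)
    ultimately have "total_curv F P v < total_curv F P' v"
      by (intro total_curv_less[OF assms(3) P vV _ M])
    moreover have "total_curv F P v = T v" "total_curv F P' v = T v"
      using assms(9,10) v by (simp_all add: realizes_def)
    ultimately show False by simp
  qed
  moreover have "curv P' v \<le> curv P v"
    if bd: "\<forall>v\<in>bdry_vertices X S V. curv P' v \<le> curv P v" and v: "v \<in> V" for v
  proof (rule ccontr)
    assume "\<not> curv P' v \<le> curv P v"
    then have "?r v > 1" using pos[OF v] by simp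
    then have M: "?M > 1" using max[OF v] by simp
    have "?M \<in> ?r ` V" using fin v by (intro Max_in) auto
    then obtain w where w: "w \<in> V" "?r w = ?M" by auto
    then have "w \<in> bdry_vertices X S V"
      using not_int[OF M] by (auto simp: int_vertices_def bdry_vertices_def)
    then have "?r w \<le> 1" using bd pos[OF w(1)] by simp
    then show False using w(2) M by simp
  qed
  ultimately show ?thesis by blast
qed

end
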